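(* Let $p\in\{3,4,6\}$ and $N=\lfloor p/2\rfloor$. With the notation of the context, consider pairs $(\mathbf x(z),\mathbf y(z))$ of formal Laurent series in $z$ (with finite principal parts), whose coefficients are holomorphic functions of $g$ on $\widetilde S_p$, which satisfy the system $$\frac{\partial \mathbf x}{\partial z}=\frac{\partial F_p}{\partial y}(\mathbf x,\mathbf y,g),\qquad \frac{\partial \mathbf y}{\partial z}=-\frac{\partial F_p}{\partial x}(\mathbf x,\mathbf y,g),$$ the energy constraint $F_p(\mathbf x,\mathbf y,g)=0$, and the weight condition that $\mathbf x$ and $\mathbf y$ are weighted homogeneous in $(z,g)$ of weights $\mathrm{wt}(x)$ and $\mathrm{wt}(y)$. There are exactly $N$ such pairs having a non-trivial pole at $z=0$ (i.e. at least one of $\mathbf x,\mathbf y$ has a pole), and the map $$(\mathbf x(z),\mathbf y(z))\ \mapsto\ \lim_{z\to0}(\mathbf x(z),\mathbf y(z))$$ is a bijection from the set of these solutions onto the set $\{\infty_1,\dots,\infty_N\}$ of points at infinity of $\overline E_g$. In particular, the linear transformation $\sigma_p$ acts on the set of solutions cyclically, equivariantly with this bijection. Moreover, the coefficients of these Laurent series are weighted homogeneous polynomials in $g_s,g_l$ with coefficients in $\mathbb Q$ (so that each solution is a pair of weighted homogeneous functions of weights $(\mathrm{wt}(x),\mathrm{wt}(y))$).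
   Context: Let $p\in\{3,4,6\}$ (types $\mathrm A_2,\mathrm B_2,\mathrm G_2$), $N=\lfloor p/2\rfloor\in\{1,2,3\}$, $S_p=\mathbb C^2$ with coordinates $g=(g_s,g_l)$, and $$F_3=y^2-(4x^3-g_sx-g_l),\quad F_4=y^2-(x^4-g_sx^2+g_l+g_s^2/8),\quad F_6=x(y^2-x^2)+g_s(3x^2+y^2)-g_l-2g_s^3 .$$ Discriminants: $\Delta_3=g_s^3-27g_l^2$, $\Delta_4=(8g_l+g_s^2)(-8g_l+g_s^2)^2$, $\Delta_6=(g_l+2g_s^3)(-g_l+2g_s^3)^3$; $D_p=\{\Delta_p=0\}$. For $g\in S_p\setminus D_p$, $E_g=\{F_p(x,y,g)=0\}\subset\mathbb C^2$ is a smooth affine curve, and $\overline E_g$ is its smooth compactification, an elliptic curve obtained by adding $N$ points at infinity $\infty_1,\dots,\infty_N$; these form $N$ sections over $S_p\setminus D_p$. $\widetilde S_p$ is the (connected) covering of $S_p\setminus D_p$ corresponding to the kernel of the monodromy representation on $H_1(\overline E_g,\mathbb Z)$. Weights $(\mathrm{wt}(x),\mathrm{wt}(y),\mathrm{wt}(g_s),\mathrm{wt}(g_l),\mathrm{wt}(z))$: $p=3$: $(\frac13,\frac12,\frac23,1,-\frac16)$; $p=4$: $(\frac14,\frac12,\frac12,1,-\frac14)$; $p=6$: $(\frac13,\frac13,\frac13,1,-\frac13)$. A series $\sum_n c_n(g)z^n$ is weighted homogeneous of weight $w$ if each $c_n$ is weighted homogeneous of weight $w-n\,\mathrm{wt}(z)$,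 i.e. $(\mathrm{wt}(g_s)g_s\partial_{g_s}+\mathrm{wt}(g_l)g_l\partial_{g_l})c_n=(w-n\,\mathrm{wt}(z))c_n$. Automorphisms of the $(x,y)$-plane: $\sigma_3(x,y)=(x,y)$, $\sigma_4(x,y)=(-x,-y)$, $\sigma_6(x,y)=\left(\frac{y-x}2,\frac{-3x-y}2\right)$. Each $\sigma_p$ preserves $F_p$, has order $N$, and permutes the points at infinity cyclically: $\sigma_p(\infty_i)=\infty_{i+1}$, $i\in\mathbb Z/N$. The limit of a formal solution: for each $g$ the pair $(\mathbf x,\mathbf y)$ is a $\mathbb C((z))$-point of $E_g$, which extends to a $\mathbb C[[z]]$-point of $\overline E_g$; the limit as $z\to0$ is the image of the closed point. *)

theory Defs
  imports "HOL-Homology.Homology" "HOL-Computational_Algebra.Formal_Laurent_Series"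
begin

subsection \<open>The families of affine curves\<close>

text \<open>
  The type is encoded by \<open>p \<in> {3, 4, 6}\<close> (for A2, B2, G2); the last branch of every
  conditional below is the case \<open>p = 6\<close>. The parameter is \<open>g = (g_s, g_l)\<close>. The polynomials are
  polymorphic because they are evaluated both at complex numbers and at Laurent series.
\<close>

definition F :: "nat \<Rightarrow> 'a::field \<Rightarrow> 'a \<Rightarrow> 'a \<times> 'a \<Rightarrow> 'a" where
  "F p x y g = (case g of (gs, gl) \<Rightarrow>
     if p = 3 then y^2 - (4 * x^3 - gs * x - gl)
     else if p = 4 then y^2 - (x^4 - gs * x^2 + gl + gs^2 / 8)
     else x * (y^2 - x^2) + gs * (3 * x^2 + y^2) - gl - 2 * gs^3)"

definition dF_dx :: "nat \<Rightarrow> 'a::field \<Rightarrow> 'a \<Rightarrow> 'a \<times> 'a \<Rightarrow> 'a" where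
  "dF_dx p x y g = (case g of (gs, gl) \<Rightarrow>
     if p = 3 then gs - 12 * x^2
     else if p = 4 then 2 * gs * x - 4 * x^3
     else y^2 - 3 * x^2 + 6 * gs * x)"

definition dF_dy :: "nat \<Rightarrow> 'a::field \<Rightarrow> 'a \<Rightarrow> 'a \<times> 'a \<Rightarrow> 'a" where
  "dF_dy p x y g = (case g of (gs, gl) \<Rightarrow>
     if p = 3 then 2 * y
     else if p = 4 then 2 * y
     else 2 * x * y + 2 * gs * y)"

lemma dF_dx_correct:
  fixes x y :: "'a::real_normed_field"
  shows "((\<lambda>x. F p x y g) has_field_derivative dF_dx p x y g) (at x)"
  unfolding F_def dF_dx_def
  by (cases g) (auto intro!: derivative_eq_intros simp: power2_eq_square power3_eq_cube algebra_simps)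

lemma dF_dy_correct:
  fixes x y :: "'a::real_normed_field"
  shows "((\<lambda>y. F p x y g) has_field_derivative dF_dy p x y g) (at y)"
  unfolding F_def dF_dy_def
  by (cases g) (auto intro!: derivative_eq_intros simp: power2_eq_square power3_eq_cube algebra_simps)

definition discr :: "nat \<Rightarrow> complex \<times> complex \<Rightarrow> complex" where
  "discr p g = (case g of (gs, gl) \<Rightarrow>
     if p = 3 then gs^3 - 27 * gl^2
     else if p = 4 then (8 * gl + gs^2) * (- 8 * gl + gs^2)^2
     else (gl + 2 * gs^3) * (- gl + 2 * gs^3)^3)"

definition regular_params :: "nat \<Rightarrow> (complex \<times> complex) set" where
  "regular_params p = {g. discr p g \<noteq> 0}"

definition wt_x :: "nat \<Rightarrow> rat" where
  "wt_x p = (if p = 3 then 1/3 else if p = 4 then 1/4 else 1/3)"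

definition wt_y :: "nat \<Rightarrow> rat" where
  "wt_y p = (if p = 3 then 1/2 else if p = 4 then 1/2 else 1/3)"

definition wt_gs :: "nat \<Rightarrow> rat" where
  "wt_gs p = (if p = 3 then 2/3 else if p = 4 then 1/2 else 1/3)"

definition wt_gl :: "nat \<Rightarrow> rat" where
  "wt_gl p = 1"

definition wt_z :: "nat \<Rightarrow> rat" where
  "wt_z p = (if p = 3 then - (1/6) else if p = 4 then - (1/4) else - (1/3))"

definition sigma :: "nat \<Rightarrow> 'a::field \<times> 'a \<Rightarrow> 'a \<times> 'a" where
  "sigma p v = (case v of (x, y) \<Rightarrow>
     if p = 3 then (x, y)
     else if p = 4 then (- x, - y)
     else ((y - x) / 2, (- 3 * x - y) / 2))"


subsection \<open>The compactified curves\<close>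

text \<open>
  The affine plane is embedded by \<open>(x, y) \<mapsto> [x : y : 1]\<close> into the weighted projective plane with
  weights \<open>(2,3,1)\<close>, \<open>(1,2,1)\<close>, \<open>(1,1,1)\<close>, which are \<open>(wt x, wt y, - wt z)\<close> divided by \<open>- wt z\<close>.
  A point of the weighted projective plane is an orbit of nonzero triples. The closure of \<open>E_g\<close> is
  given by the weighted homogenization of \<open>F\<close>. Its points with \<open>w = 0\<close> avoid the singular points
  of the weighted projective plane, and the gradient of the homogenization is nonzero there; so the
  closure is smooth whenever \<open>E_g\<close> is (for \<open>p = 4\<close> the closure in the ordinary projective plane is
  not).
\<close>

definition pw_x :: "nat \<Rightarrow> nat" where
  "pw_x p = (if p = 3 then 2 else 1)"

definition pw_y :: "nat \<Rightarrow> nat" where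
  "pw_y p = (if p = 3 then 3 else if p = 4 then 2 else 1)"

lemma pw_weights:
  "wt_x p = - wt_z p * of_nat (pw_x p)" "wt_y p = - wt_z p * of_nat (pw_y p)"
  by (auto simp: wt_x_def wt_y_def wt_z_def pw_x_def pw_y_def)

definition F_hom :: "nat \<Rightarrow> complex \<times> complex \<times> complex \<Rightarrow> complex \<times> complex \<Rightarrow> complex" where
  "F_hom p v g = (case v of (x, y, w) \<Rightarrow> case g of (gs, gl) \<Rightarrow>
     if p = 3 then y^2 - (4 * x^3 - gs * x * w^4 - gl * w^6)
     else if p = 4 then y^2 - (x^4 - gs * x^2 * w^2 + (gl + gs^2 / 8) * w^4)
     else x * (y^2 - x^2) + gs * (3 * x^2 + y^2) * w - (gl + 2 * gs^3) * w^3)"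

definition wscale :: "nat \<Rightarrow> 'a::field \<Rightarrow> 'a \<times> 'a \<times> 'a \<Rightarrow> 'a \<times> 'a \<times> 'a" where
  "wscale p l v = (case v of (x, y, w) \<Rightarrow> (l ^ pw_x p * x, l ^ pw_y p * y, l * w))"

lemma F_hom_affine: "F_hom p (x, y, 1) g = F p x y g"
  by (cases g) (simp add: F_hom_def F_def algebra_simps)

lemma F_hom_wscale:
  "F_hom p (wscale p l v) g =
     l ^ (if p = 3 then 6 else if p = 4 then 4 else 3) * F_hom p v g"
  by (cases g; cases v)
     (auto simp: F_hom_def wscale_def pw_x_def pw_y_def algebra_simps power_mult_distrib
       simp flip: power_mult power_add,
      auto simp: power2_eq_square power3_eq_cube algebra_simps)

definition wpoint :: "nat \<Rightarrow> complex \<times> complex \<times> complex \<Rightarrow> (complex \<times> complex \<times> complex) set" where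
  "wpoint p v = {wscale p l v | l. l \<noteq> 0}"

definition wplane :: "nat \<Rightarrow> (complex \<times> complex \<times> complex) set set" where
  "wplane p = wpoint p ` (UNIV - {0})"

text \<open>The quotient topology: a set of orbits is open iff the union of these orbits is open.\<close>

definition wplane_topology :: "nat \<Rightarrow> (complex \<times> complex \<times> complex) set topology" where
  "wplane_topology p = topology (\<lambda>U. U \<subseteq> wplane p \<and> open (\<Union>U))"

lemma wscale_wscale: "wscale p l (wscale p m v) = wscale p (l * m) v"
  by (cases v) (simp add: wscale_def power_mult_distrib)

lemma wscale_one [simp]: "wscale p 1 v = v"
  by (cases v) (simp add: wscale_def)

lemma wpoint_eq_if_mem:
  assumes "u \<in> wpoint p v"
  shows "wpoint p u = wpoint p v"
proof -
  obtain l where l: "l \<noteq> 0" "u = wscale p l v"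
    using assms by (auto simp: wpoint_def)
  show ?thesis
  proof (intro equalityI subsetI)
    fix a assume "a \<in> wpoint p u"
    then obtain m where "m \<noteq> 0" "a = wscale p (m * l) v"
      using l by (auto simp: wpoint_def wscale_wscale)
    then show "a \<in> wpoint p v"
      using l(1) unfolding wpoint_def by (metis (mono_tags, lifting) mem_Collect_eq mult_eq_0_iff)
  next
    fix a assume "a \<in> wpoint p v"
    then obtain m where m: "m \<noteq> 0" "a = wscale p m v"
      by (auto simp: wpoint_def)
    then have "a = wscale p (m / l) u" "m / l \<noteq> 0"
      using l by (auto simp: wscale_wscale)
    then show "a \<in> wpoint p u"
      unfolding wpoint_def by blast
  qed
qed

lemma wplane_disjoint:
  assumes "P \<in> wplane p" "Q \<in> wplane p" "u \<in> P" "u \<in> Q"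
  shows "P = Q"
  using assms wpoint_eq_if_mem unfolding wplane_def by blast

lemma openin_wplane_topology:
  "openin (wplane_topology p) U \<longleftrightarrow> U \<subseteq> wplane p \<and> open (\<Union>U)"
proof -
  have "istopology (\<lambda>U. U \<subseteq> wplane p \<and> open (\<Union>U))"
    unfolding istopology_def
  proof (intro conjI allI impI)
    fix S T assume "S \<subseteq> wplane p \<and> open (\<Union>S)" "T \<subseteq> wplane p \<and> open (\<Union>T)"
    moreover from this have "\<Union>(S \<inter> T) = \<Union>S \<inter> \<Union>T"
      using wplane_disjoint by blast
    ultimately show "S \<inter> T \<subseteq> wplane p" "open (\<Union>(S \<inter> T))" by auto
  next
    fix K assume K: "\<forall>S\<in>K. S \<subseteq> wplane p \<and> open (\<Union>S)"
    then show "\<Union>K \<subseteq> wplane p" by blast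
    have "\<Union>(\<Union>K) = (\<Union>S\<in>K. \<Union>S)" by blast
    then show "open (\<Union>(\<Union>K))" using K by auto
  qed
  then show ?thesis by (simp add: wplane_topology_def)
qed

definition compact_curve :: "nat \<Rightarrow> complex \<times> complex \<Rightarrow> (complex \<times> complex \<times> complex) set set" where
  "compact_curve p g = {wpoint p v | v. v \<noteq> 0 \<and> F_hom p v g = 0}"

definition points_at_infinity :: "nat \<Rightarrow> complex \<times> complex \<Rightarrow> (complex \<times> complex \<times> complex) set set" where
  "points_at_infinity p g =
     {wpoint p (x, y, 0) | x y. (x, y) \<noteq> 0 \<and> F_hom p (x, y, 0) g = 0}"

definition compact_curve_topology :: "nat \<Rightarrow> complex \<times> complex \<Rightarrow> (complex \<times> complex \<times> complex) set topology" where
  "compact_curve_topology p g = subtopology (wplane_topology p) (compact_curve p g)"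

text \<open>The linear map \<open>sigma\<close> commutes with the scaling action and hence acts on orbits.\<close>

definition sigma_wpoint ::
    "nat \<Rightarrow> (complex \<times> complex \<times> complex) set \<Rightarrow> (complex \<times> complex \<times> complex) set" where
  "sigma_wpoint p P = (\<lambda>(x, y, w). (fst (sigma p (x, y)), snd (sigma p (x, y)), w)) ` P"

lemma sigma_wpoint_wpoint:
  "sigma_wpoint p (wpoint p (x, y, w)) =
     wpoint p (fst (sigma p (x, y)), snd (sigma p (x, y)), w)"
proof -
  have *: "(\<lambda>(x, y, w). (fst (sigma p (x, y)), snd (sigma p (x, y)), w)) (wscale p l (x, y, w)) =
      wscale p l (fst (sigma p (x, y)), snd (sigma p (x, y)), w)" for l :: complex
    by (simp add: wscale_def sigma_def pw_x_def pw_y_def field_simps)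
  show ?thesis
    by (simp only: sigma_wpoint_def wpoint_def setcompr_eq_image image_image *)
qed


subsection \<open>Monodromy and the covering of the regular parameters\<close>

text \<open>
  Let \<open>\<gamma>\<close> be a path of regular parameters. The family of curves pulled back along \<open>\<gamma>\<close> is a fibre
  bundle over \<open>[0, 1]\<close>, so the inclusions of the two end fibres into its total space are homotopy
  equivalences. Parallel transport on first integral homology along \<open>\<gamma>\<close> is the first induced map
  followed by the inverse of the second one; it is given here by its graph.
\<close>

definition pullback_topology ::
    "nat \<Rightarrow> (real \<Rightarrow> complex \<times> complex) \<Rightarrow> (real \<times> (complex \<times> complex \<times> complex) set) topology" where
  "pullback_topology p \<gamma> =
     subtopology (prod_topology (top_of_set {0..1}) (wplane_topology p))
       {(u, P). P \<in> compact_curve p (\<gamma> u)}"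

definition H1_transport where
  "H1_transport p \<gamma> \<alpha> \<beta> \<longleftrightarrow>
     \<alpha> \<in> carrier (homology_group 1 (compact_curve_topology p (pathstart \<gamma>))) \<and>
     \<beta> \<in> carrier (homology_group 1 (compact_curve_topology p (pathfinish \<gamma>))) \<and>
     hom_induced 1 (compact_curve_topology p (pathstart \<gamma>)) {} (pullback_topology p \<gamma>) {} (Pair 0) \<alpha> =
     hom_induced 1 (compact_curve_topology p (pathfinish \<gamma>)) {} (pullback_topology p \<gamma>) {} (Pair 1) \<beta>"

definition trivial_monodromy :: "nat \<Rightarrow> (real \<Rightarrow> complex \<times> complex) \<Rightarrow> bool" where
  "trivial_monodromy p \<gamma> \<longleftrightarrow>
     (\<forall>\<alpha> \<in> carrier (homology_group 1 (compact_curve_topology p (pathstart \<gamma>))). H1_transport p \<gamma> \<alpha> \<alpha>)"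

text \<open>
  A connected covering is determined up to isomorphism by the loops that lift to loops; here these
  have to be the loops in the kernel of the monodromy representation. As the kernel is a normal
  subgroup, all points \<open>t\<close> of the covering may serve as base point.
\<close>

definition monodromy_covering ::
    "nat \<Rightarrow> 'a::topological_space set \<Rightarrow> ('a \<Rightarrow> complex \<times> complex) \<Rightarrow> bool" where
  "monodromy_covering p C \<pi> \<longleftrightarrow>
     connected C \<and> covering_space C \<pi> (regular_params p) \<and>
     (\<forall>t \<in> C. \<forall>\<gamma>. path \<gamma> \<and> path_image \<gamma> \<subseteq> regular_params p \<and>
          pathstart \<gamma> = \<pi> t \<and> pathfinish \<gamma> = \<pi> t \<longrightarrow>
        (trivial_monodromy p \<gamma> \<longleftrightarrow>
          (\<exists>\<delta>. path \<delta> \<and> path_image \<delta> \<subseteq> C \<and> pathstart \<delta> = t \<and> pathfinish \<delta> = t \<and>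
               (\<forall>u \<in> {0..1}. \<pi> (\<delta> u) = \<gamma> u))))"

text \<open>
  \<open>cover_partials C \<pi> f t a b\<close>: in the local coordinates \<open>(g_s, g_l)\<close> given by the covering map,
  \<open>f\<close> is complex differentiable at \<open>t\<close> with partial derivatives \<open>a\<close> and \<open>b\<close>.
\<close>

definition cover_partials ::
    "'a::topological_space set \<Rightarrow> ('a \<Rightarrow> complex \<times> complex) \<Rightarrow> ('a \<Rightarrow> complex) \<Rightarrow> 'a \<Rightarrow>
       complex \<Rightarrow> complex \<Rightarrow> bool" where
  "cover_partials C \<pi> f t a b \<longleftrightarrow>
     (\<exists>U V q. openin (top_of_set C) U \<and> t \<in> U \<and> open V \<and> homeomorphism U V \<pi> q \<and>
        ((\<lambda>g. f (q g)) has_derivative (\<lambda>(h, k). a * h + b * k)) (at (\<pi> t)))"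

definition cover_holomorphic ::
    "'a::topological_space set \<Rightarrow> ('a \<Rightarrow> complex \<times> complex) \<Rightarrow> ('a \<Rightarrow> complex) \<Rightarrow> bool" where
  "cover_holomorphic C \<pi> f \<longleftrightarrow> (\<forall>t \<in> C. \<exists>a b. cover_partials C \<pi> f t a b)"

definition cover_weighted_homogeneous ::
    "nat \<Rightarrow> 'a::topological_space set \<Rightarrow> ('a \<Rightarrow> complex \<times> complex) \<Rightarrow> rat \<Rightarrow> ('a \<Rightarrow> complex) \<Rightarrow> bool" where
  "cover_weighted_homogeneous p C \<pi> w f \<longleftrightarrow>
     (\<forall>t \<in> C. \<exists>a b. cover_partials C \<pi> f t a b \<and>
        of_rat (wt_gs p) * fst (\<pi> t) * a + of_rat (wt_gl p) * snd (\<pi> t) * b = of_rat w * f t)"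


subsection \<open>Formal solutions and their limits\<close>

text \<open>
  A Laurent series with holomorphic functions on the covering \<open>C\<close> as coefficients is represented by
  the family of its specializations at the points of \<open>C\<close>. The order of the pole has to be bounded
  uniformly. Families are extensional, so that equality of families is equality on \<open>C\<close>.
\<close>

definition laurent_family ::
    "'a::topological_space set \<Rightarrow> ('a \<Rightarrow> complex \<times> complex) \<Rightarrow> ('a \<Rightarrow> complex fls) \<Rightarrow> bool" where
  "laurent_family C \<pi> X \<longleftrightarrow>
     X \<in> extensional C \<and>
     (\<exists>m. \<forall>n<m. \<forall>t \<in> C. fls_nth (X t) n = 0) \<and>
     (\<forall>n. cover_holomorphic C \<pi> (\<lambda>t. fls_nth (X t) n))"

definition homogeneous_family ::
    "nat \<Rightarrow> 'a::topological_space set \<Rightarrow> ('a \<Rightarrow> complex \<times> complex) \<Rightarrow> rat \<Rightarrow> ('a \<Rightarrow> complex fls) \<Rightarrow> bool" where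
  "homogeneous_family p C \<pi> w X \<longleftrightarrow>
     (\<forall>n. cover_weighted_homogeneous p C \<pi> (w - of_int n * wt_z p) (\<lambda>t. fls_nth (X t) n))"

definition const_param :: "complex \<times> complex \<Rightarrow> complex fls \<times> complex fls" where
  "const_param g = (fls_const (fst g), fls_const (snd g))"

definition formal_solution ::
    "nat \<Rightarrow> 'a::topological_space set \<Rightarrow> ('a \<Rightarrow> complex \<times> complex) \<Rightarrow>
       ('a \<Rightarrow> complex fls) \<times> ('a \<Rightarrow> complex fls) \<Rightarrow> bool" where
  "formal_solution p C \<pi> s \<longleftrightarrow> (case s of (X, Y) \<Rightarrow>
     laurent_family C \<pi> X \<and> laurent_family C \<pi> Y \<and>
     (\<forall>t \<in> C. fls_deriv (X t) = dF_dy p (X t) (Y t) (const_param (\<pi> t)) \<and>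
              fls_deriv (Y t) = - dF_dx p (X t) (Y t) (const_param (\<pi> t)) \<and>
              F p (X t) (Y t) (const_param (\<pi> t)) = 0) \<and>
     homogeneous_family p C \<pi> (wt_x p) X \<and> homogeneous_family p C \<pi> (wt_y p) Y)"

definition has_pole :: "'a set \<Rightarrow> ('a \<Rightarrow> complex fls) \<Rightarrow> bool" where
  "has_pole C X \<longleftrightarrow> (\<exists>n<0. \<exists>t \<in> C. fls_nth (X t) n \<noteq> 0)"

definition polar_solutions ::
    "nat \<Rightarrow> 'a::topological_space set \<Rightarrow> ('a \<Rightarrow> complex \<times> complex) \<Rightarrow>
       (('a \<Rightarrow> complex fls) \<times> ('a \<Rightarrow> complex fls)) set" where
  "polar_solutions p C \<pi> =
     {s. formal_solution p C \<pi> s \<and> (has_pole C (fst s) \<or> has_pole C (snd s))}"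

definition sigma_family ::
    "nat \<Rightarrow> 'a set \<Rightarrow> ('a \<Rightarrow> complex fls) \<times> ('a \<Rightarrow> complex fls) \<Rightarrow>
       ('a \<Rightarrow> complex fls) \<times> ('a \<Rightarrow> complex fls)" where
  "sigma_family p C s =
     (restrict (\<lambda>t. fst (sigma p (fst s t, snd s t))) C,
      restrict (\<lambda>t. snd (sigma p (fst s t, snd s t))) C)"

text \<open>
  The point \<open>[X : Y : 1]\<close> over the field of Laurent series extends to a point over the ring of
  power series: rescale the triple such that all entries are power series whose constant terms do
  not all vanish. The limit for \<open>z \<rightarrow> 0\<close> is the image of the closed point, that is, the point given
  by the constant terms.
\<close>

definition laurent_limit ::
    "nat \<Rightarrow> complex fls \<Rightarrow> complex fls \<Rightarrow> (complex \<times> complex \<times> complex) set \<Rightarrow> bool" where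
  "laurent_limit p X Y P \<longleftrightarrow>
     (\<exists>l A B W. l \<noteq> 0 \<and> wscale p l (X, Y, 1) = (A, B, W) \<and>
        fls_subdegree A \<ge> 0 \<and> fls_subdegree B \<ge> 0 \<and> fls_subdegree W \<ge> 0 \<and>
        (fls_nth A 0, fls_nth B 0, fls_nth W 0) \<noteq> 0 \<and>
        P = wpoint p (fls_nth A 0, fls_nth B 0, fls_nth W 0))"

lemma fls_nth_mult_0:
  fixes f g :: "complex fls"
  assumes "fls_subdegree f \<ge> 0" "fls_subdegree g \<ge> 0"
  shows "fls_nth (f * g) 0 = fls_nth f 0 * fls_nth g 0" "fls_subdegree (f * g) \<ge> 0"
proof -
  have fg: "fps_to_fls (fls_regpart f) = f" "fps_to_fls (fls_regpart g) = g"
    using assms by simp_all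
  have eq: "f * g = fps_to_fls (fls_regpart f * fls_regpart g)"
    using fg by (simp add: fls_times_fps_to_fls)
  show "fls_nth (f * g) 0 = fls_nth f 0 * fls_nth g 0"
    unfolding eq by simp
  show "fls_subdegree (f * g) \<ge> 0"
    unfolding eq by (rule fls_subdegree_fls_to_fps_gt0)
qed

lemma fls_nth_power_0:
  fixes f :: "complex fls"
  assumes "fls_subdegree f \<ge> 0"
  shows "fls_nth (f ^ n) 0 = fls_nth f 0 ^ n \<and> fls_subdegree (f ^ n) \<ge> 0"
  using assms by (induction n) (auto simp: fls_nth_mult_0)

lemma laurent_limit_unique:
  assumes "laurent_limit p X Y P" "laurent_limit p X Y Q"
  shows "P = Q"
proof -
  have *: "P' = Q'"
    if l: "l \<noteq> 0" "wscale p l (X, Y, 1) = (A, B, W)"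
      and "fls_subdegree A \<ge> 0" "fls_subdegree B \<ge> 0" "fls_subdegree W \<ge> 0"
      and P': "P' = wpoint p (fls_nth A 0, fls_nth B 0, fls_nth W 0)"
      and l': "l' \<noteq> 0" "wscale p l' (X, Y, 1) = (A', B', W')"
      and nz: "(fls_nth A' 0, fls_nth B' 0, fls_nth W' 0) \<noteq> 0"
      and Q': "Q' = wpoint p (fls_nth A' 0, fls_nth B' 0, fls_nth W' 0)"
      and le: "fls_subdegree l \<le> fls_subdegree l'"
    for l l' A B W A' B' W' P' Q'
  proof -
    define m where "m = l' / l"
    have m: "fls_subdegree m \<ge> 0"
      using le l l' by (simp add: m_def fls_divide_subdegree)
    have "(A', B', W') = wscale p m (A, B, W)"
      using l l' by (metis m_def wscale_wscale nonzero_eq_divide_eq)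
    then have "(fls_nth A' 0, fls_nth B' 0, fls_nth W' 0) =
        wscale p (fls_nth m 0) (fls_nth A 0, fls_nth B 0, fls_nth W 0)"
      using m that by (simp add: wscale_def fls_nth_mult_0 fls_nth_power_0)
    moreover from this have "fls_nth m 0 \<noteq> 0"
      using nz by (auto simp: wscale_def pw_x_def pw_y_def zero_prod_def split: if_splits)
    ultimately have "(fls_nth A' 0, fls_nth B' 0, fls_nth W' 0) \<in>
        wpoint p (fls_nth A 0, fls_nth B 0, fls_nth W 0)"
      unfolding wpoint_def by blast
    then show "P' = Q'"
      using wpoint_eq_if_mem P' Q' by metis
  qed
  show ?thesis
    using assms unfolding laurent_limit_def
    by (elim exE conjE) (metis * linorder_le_cases)
qed

definition rational_weighted_poly :: "nat \<Rightarrow> rat \<Rightarrow> (complex \<times> complex \<Rightarrow> complex) \<Rightarrow> bool" where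
  "rational_weighted_poly p w f \<longleftrightarrow>
     (\<exists>c :: nat \<times> nat \<Rightarrow> rat. finite {m. c m \<noteq> 0} \<and>
        (\<forall>i j. c (i, j) \<noteq> 0 \<longrightarrow> of_nat i * wt_gs p + of_nat j * wt_gl p = w) \<and>
        (\<forall>gs gl. f (gs, gl) = (\<Sum>(i, j) | c (i, j) \<noteq> 0. of_rat (c (i, j)) * gs ^ i * gl ^ j)))"

end

theory Submission
  imports Defs
begin

text \<open>
  Near the points at infinity each curve has coordinates in which the Hamiltonian system is again a
  polynomial Hamiltonian system, now regular. A Laurent solution with a pole on the zero level is the
  same as a power series solution starting at a point at infinity, so by existence and uniqueness for
  formal initial value problems there is exactly one for every such point. The recursion for the
  coefficients preserves weighted homogeneity and rationality. Over the covering, the leading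
  coefficients are continuous functions with finitely many values; as the covering is connected,
  a solution belongs to the same point at infinity everywhere.
\<close>

text \<open>Two facts make the charts work. In the coordinates (u, v) one has F = r H and dx dy =
  \<plusminus> r du dv with the same monomial r, namely 1/v^3, 1/u^4, 1/u^3 for p = 3, 4, 6. On the
  zero level a factor common to F and the area form cancels from the Hamiltonian field, so what
  remains is the field of H up to sign, which is regular at infinity. Off the zero level this fails
  in general; hence the energy constraint enters the change of coordinates. Moreover, this field
  crosses u = 0 transversally at every point at infinity: u'(0) is -1, -2 v(0), 1 - 3 v(0)^2. So u
  has a simple zero, the pole orders of (x, y) are at most (2, 3), (1, 2), (1, 1), and the
  coefficients at these orders are rational numbers that depend on the point at infinity but not on
  g. They serve as a discrete label of a solution: they determine the initial value, sigma permutes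
  them, continuity over the covering freezes them, and they are the coordinates of the limit
  point.\<close>

unbundle no vec_syntax and fps_syntax

subsection \<open>Weighted homogeneous polynomials\<close>

lemma rational_weighted_polyE:
  assumes "rational_weighted_poly p w f"
  obtains S c where "finite S"
    "\<And>i j. (i, j) \<in> S \<Longrightarrow> of_nat i * wt_gs p + of_nat j * wt_gl p = w"
    "f = (\<lambda>g. \<Sum>(i, j)\<in>S. of_rat (c (i, j)) * fst g ^ i * snd g ^ j)"
proof -
  obtain c where c: "finite {m. c m \<noteq> 0}"
      "\<And>i j. c (i, j) \<noteq> 0 \<Longrightarrow> of_nat i * wt_gs p + of_nat j * wt_gl p = w"
      "\<And>gs gl. f (gs, gl) = (\<Sum>(i, j) | c (i, j) \<noteq> 0. of_rat (c (i, j)) * gs ^ i * gl ^ j)"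
    using assms unfolding rational_weighted_poly_def by blast
  have "f = (\<lambda>g. \<Sum>(i, j)\<in>{m. c m \<noteq> 0}. of_rat (c (i, j)) * fst g ^ i * snd g ^ j)"
  proof
    fix g
    show "f g = (\<Sum>(i, j)\<in>{m. c m \<noteq> 0}. of_rat (c (i, j)) * fst g ^ i * snd g ^ j)"
      using c(3)[of "fst g" "snd g"] by (simp add: case_prod_unfold)
  qed
  then show ?thesis
    using c(1,2) that[of "{m. c m \<noteq> 0}" c] by auto
qed

lemma rational_weighted_poly_zero: "rational_weighted_poly p w (\<lambda>g. 0)"
  unfolding rational_weighted_poly_def by (rule exI[of _ "\<lambda>_. 0"]) simp

lemma rational_weighted_poly_monomial:
  assumes "of_nat i * wt_gs p + of_nat j * wt_gl p = w"
  shows "rational_weighted_poly p w (\<lambda>g. of_rat c * fst g ^ i * snd g ^ j)"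
proof (cases "c = 0")
  case False
  have *: "{m. (if m = (i, j) then c else 0) \<noteq> 0} = {(i, j)}"
    using False by auto
  show ?thesis
    unfolding rational_weighted_poly_def
  proof (intro exI[of _ "\<lambda>m. if m = (i, j) then c else 0"] conjI allI)
    show "finite {m. (if m = (i, j) then c else 0) \<noteq> 0}"
      by (simp add: *)
    show "(if (i', j') = (i, j) then c else 0) \<noteq> 0 \<longrightarrow>
        of_nat i' * wt_gs p + of_nat j' * wt_gl p = w" for i' j'
      using assms by auto
    show "of_rat c * fst (gs, gl) ^ i * snd (gs, gl) ^ j =
        (\<Sum>(i', j') | (if (i', j') = (i, j) then c else 0) \<noteq> 0.
          of_rat (if (i', j') = (i, j) then c else 0) * gs ^ i' * gl ^ j')" for gs gl
    proof -
      have "{(i', j'). (if (i', j') = (i, j) then c else 0) \<noteq> 0} = {(i, j)}"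
        using False by auto
      then show ?thesis
        by (simp only:) simp
    qed
  qed
qed (simp add: rational_weighted_poly_zero)

lemma rational_weighted_poly_add:
  assumes "rational_weighted_poly p w f" "rational_weighted_poly p w h"
  shows "rational_weighted_poly p w (\<lambda>g. f g + h g)"
proof -
  obtain c where c: "finite {m. c m \<noteq> 0}"
      "\<And>i j. c (i, j) \<noteq> 0 \<Longrightarrow> of_nat i * wt_gs p + of_nat j * wt_gl p = w"
      "\<And>gs gl. f (gs, gl) = (\<Sum>(i, j) | c (i, j) \<noteq> 0. of_rat (c (i, j)) * gs ^ i * gl ^ j)"
    using assms(1) unfolding rational_weighted_poly_def by blast
  obtain d where d: "finite {m. d m \<noteq> 0}"
      "\<And>i j. d (i, j) \<noteq> 0 \<Longrightarrow> of_nat i * wt_gs p + of_nat j * wt_gl p = w"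
      "\<And>gs gl. h (gs, gl) = (\<Sum>(i, j) | d (i, j) \<noteq> 0. of_rat (d (i, j)) * gs ^ i * gl ^ j)"
    using assms(2) unfolding rational_weighted_poly_def by blast
  let ?S = "{m. c m \<noteq> 0} \<union> {m. d m \<noteq> 0}"
  \<comment> \<open>Cancellation can make the support of \<open>c + d\<close> smaller than the union
    of the supports, so all three sums are taken over the union, where the additional terms
    vanish.\<close>
  have extend: "(\<Sum>(i, j) | e (i, j) \<noteq> 0. of_rat (e (i, j)) * gs ^ i * gl ^ j) =
      (\<Sum>(i, j)\<in>?S. of_rat (e (i, j)) * gs ^ i * gl ^ j)"
    if "{m. e m \<noteq> 0} \<subseteq> ?S" for e :: "nat \<times> nat \<Rightarrow> rat" and gs gl :: complex
    using c(1) d(1) that by (intro sum.mono_neutral_left) auto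
  have sub: "{m. c m \<noteq> 0} \<subseteq> ?S" "{m. d m \<noteq> 0} \<subseteq> ?S" "{m. c m + d m \<noteq> 0} \<subseteq> ?S"
    by auto
  show ?thesis
    unfolding rational_weighted_poly_def
  proof (intro exI[of _ "\<lambda>m. c m + d m"] conjI allI)
    show "finite {m. c m + d m \<noteq> 0}"
      using sub(3) c(1) d(1) by (meson finite_UnI finite_subset)
    show "c (i, j) + d (i, j) \<noteq> 0 \<longrightarrow> of_nat i * wt_gs p + of_nat j * wt_gl p = w" for i j
      using c(2)[of i j] d(2)[of i j] by (cases "c (i, j) = 0") auto
    show "f (gs, gl) + h (gs, gl) =
        (\<Sum>(i, j) | c (i, j) + d (i, j) \<noteq> 0. of_rat (c (i, j) + d (i, j)) * gs ^ i * gl ^ j)" for gs gl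
      unfolding c(3) d(3) extend[OF sub(1)] extend[OF sub(2)] extend[OF sub(3)] sum.distrib[symmetric]
      by (intro sum.cong) (auto simp: of_rat_add algebra_simps)
  qed
qed

lemma rational_weighted_poly_sum:
  assumes "\<And>x. x \<in> A \<Longrightarrow> rational_weighted_poly p w (f x)"
  shows "rational_weighted_poly p w (\<lambda>g. \<Sum>x\<in>A. f x g)"
  using assms
  by (induction A rule: infinite_finite_induct)
    (auto intro: rational_weighted_poly_zero rational_weighted_poly_add)

lemma rational_weighted_poly_mult:
  assumes "rational_weighted_poly p w f" "rational_weighted_poly p w' h"
  shows "rational_weighted_poly p (w + w') (\<lambda>g. f g * h g)"
proof -
  obtain S c where S: "\<And>i j. (i, j) \<in> S \<Longrightarrow> of_nat i * wt_gs p + of_nat j * wt_gl p = w"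
    and f: "f = (\<lambda>g. \<Sum>(i, j)\<in>S. of_rat (c (i, j)) * fst g ^ i * snd g ^ j)"
    using assms(1) by (elim rational_weighted_polyE) blast
  obtain T d where T: "\<And>i j. (i, j) \<in> T \<Longrightarrow> of_nat i * wt_gs p + of_nat j * wt_gl p = w'"
    and h: "h = (\<lambda>g. \<Sum>(i, j)\<in>T. of_rat (d (i, j)) * fst g ^ i * snd g ^ j)"
    using assms(2) by (elim rational_weighted_polyE) blast
  have eq: "(\<lambda>g. f g * h g) = (\<lambda>g. \<Sum>x\<in>S. \<Sum>y\<in>T. of_rat (c x * d y) *
      fst g ^ (fst x + fst y) * snd g ^ (snd x + snd y))"
    unfolding f h sum_product case_prod_unfold of_rat_mult power_add
    by (intro ext sum.cong refl) (simp add: mult_ac)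
  have "of_nat (fst x + fst y) * wt_gs p + of_nat (snd x + snd y) * wt_gl p = w + w'"
    if "x \<in> S" "y \<in> T" for x y
    using S[of "fst x" "snd x"] T[of "fst y" "snd y"] that by (simp add: algebra_simps)
  then show ?thesis
    unfolding eq by (intro rational_weighted_poly_sum rational_weighted_poly_monomial)
qed

lemma rational_weighted_poly_const: "rational_weighted_poly p 0 (\<lambda>g. of_rat c)"
  using rational_weighted_poly_monomial[of 0 p 0 0 c] by simp

lemma rational_weighted_poly_cmult:
  assumes "rational_weighted_poly p w f"
  shows "rational_weighted_poly p w (\<lambda>g. of_rat c * f g)"
  using rational_weighted_poly_mult[OF rational_weighted_poly_const assms] by simp

lemma rational_weighted_poly_uminus:
  assumes "rational_weighted_poly p w f"
  shows "rational_weighted_poly p w (\<lambda>g. - f g)"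
  using rational_weighted_poly_cmult[OF assms, of "-1"] by simp

text \<open>Euler's identity: the weighted Euler field multiplies each monomial by its weight. It
  links the algebraic notion of weight to the differential one used over the covering.\<close>

lemma rational_weighted_poly_derivatives:
  assumes "rational_weighted_poly p w f"
  shows "\<exists>a b. (f has_derivative (\<lambda>(h, k). a * h + b * k)) (at g) \<and>
    of_rat (wt_gs p) * fst g * a + of_rat (wt_gl p) * snd g * b = of_rat w * f g"
proof -
  obtain S c where S: "\<And>i j. (i, j) \<in> S \<Longrightarrow> of_nat i * wt_gs p + of_nat j * wt_gl p = w"
    and f: "f = (\<lambda>g. \<Sum>(i, j)\<in>S. of_rat (c (i, j)) * fst g ^ i * snd g ^ j)"
    using assms by (elim rational_weighted_polyE) blast
  define a where "a = (\<Sum>(i, j)\<in>S. of_rat (c (i, j)) * (of_nat i * fst g ^ (i - 1)) * snd g ^ j)"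
  define b where "b = (\<Sum>(i, j)\<in>S. of_rat (c (i, j)) * fst g ^ i * (of_nat j * snd g ^ (j - 1)))"
  have "(f has_derivative (\<lambda>v. a * fst v + b * snd v)) (at g)"
  proof -
    have "((\<lambda>g. of_rat (c (i, j)) * fst g ^ i * snd g ^ j) has_derivative
        (\<lambda>v. of_rat (c (i, j)) * (of_nat i * fst g ^ (i - 1)) * snd g ^ j * fst v +
             of_rat (c (i, j)) * fst g ^ i * (of_nat j * snd g ^ (j - 1)) * snd v)) (at g)" for i j
      by (auto intro!: derivative_eq_intros simp: algebra_simps)
    then have "(f has_derivative (\<lambda>v. \<Sum>(i, j)\<in>S.
        of_rat (c (i, j)) * (of_nat i * fst g ^ (i - 1)) * snd g ^ j * fst v +
        of_rat (c (i, j)) * fst g ^ i * (of_nat j * snd g ^ (j - 1)) * snd v)) (at g)"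
      unfolding f case_prod_unfold by (intro has_derivative_sum) auto
    then show ?thesis
      by (simp add: a_def b_def case_prod_unfold sum.distrib sum_distrib_right)
  qed
  moreover have "of_rat (wt_gs p) * fst g * a + of_rat (wt_gl p) * snd g * b = of_rat w * f g"
  proof -
    \<comment> \<open>The truncated exponent \<open>k - 1\<close> is wrong only for k = 0, where the
      factor \<open>of_nat k\<close> vanishes.\<close>
    have *: "of_nat k * x * x ^ (k - 1) = of_nat k * x ^ k" for k and x :: complex
      by (cases k) auto
    have "of_rat (wt_gs p) * fst g * a + of_rat (wt_gl p) * snd g * b =
        (\<Sum>(i, j)\<in>S. of_rat (c (i, j)) *
          (of_rat (wt_gs p) * (of_nat i * fst g * fst g ^ (i - 1)) * snd g ^ j +
           of_rat (wt_gl p) * fst g ^ i * (of_nat j * snd g * snd g ^ (j - 1))))"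
      unfolding a_def b_def sum_distrib_left case_prod_unfold sum.distrib[symmetric]
      by (intro sum.cong refl) (simp add: algebra_simps)
    also have "\<dots> = (\<Sum>(i, j)\<in>S. of_rat (of_nat i * wt_gs p + of_nat j * wt_gl p) *
        (of_rat (c (i, j)) * fst g ^ i * snd g ^ j))"
      unfolding * case_prod_unfold
      by (intro sum.cong refl) (simp add: of_rat_add of_rat_mult algebra_simps)
    also have "\<dots> = of_rat w * f g"
      unfolding f sum_distrib_left by (intro sum.cong) (auto simp: S)
    finally show ?thesis .
  qed
  ultimately show ?thesis
    by (auto simp: case_prod_unfold)
qed


subsection \<open>Formal initial value problems\<close>

text \<open>Congruence modulo z^(n+1), which is compatible with all ring operations.\<close>

definition agree_upto :: "nat \<Rightarrow> 'a::zero fps \<Rightarrow> 'a fps \<Rightarrow> bool" where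
  "agree_upto n u v \<longleftrightarrow> (\<forall>k\<le>n. u $ k = v $ k)"

lemma agree_upto_refl: "agree_upto n u u"
  by (simp add: agree_upto_def)

lemma agree_upto_add:
  "agree_upto n u u' \<Longrightarrow> agree_upto n v v' \<Longrightarrow> agree_upto n (u + v) (u' + v' :: 'a::monoid_add fps)"
  by (simp add: agree_upto_def)

lemma agree_upto_uminus: "agree_upto n u u' \<Longrightarrow> agree_upto n (- u) (- u' :: 'a::ring_1 fps)"
  by (simp add: agree_upto_def)

lemma agree_upto_diff:
  "agree_upto n u u' \<Longrightarrow> agree_upto n v v' \<Longrightarrow> agree_upto n (u - v) (u' - v' :: 'a::ring_1 fps)"
  by (simp add: agree_upto_def)

lemma agree_upto_mult:
  fixes u u' v v' :: "'a::semiring_1 fps"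
  assumes "agree_upto n u u'" "agree_upto n v v'"
  shows "agree_upto n (u * v) (u' * v')"
  using assms by (auto simp: agree_upto_def fps_mult_nth intro!: sum.cong)

lemma agree_upto_power:
  "agree_upto n u u' \<Longrightarrow> agree_upto n (u ^ k) (u' ^ k :: 'a::semiring_1 fps)"
  by (induction k) (auto intro: agree_upto_refl agree_upto_mult)

lemmas agree_upto_intros =
  agree_upto_refl agree_upto_add agree_upto_uminus agree_upto_diff agree_upto_mult agree_upto_power

text \<open>Operators that do not expand the z-adic distance. Differentiation loses exactly one
  order, so with such a right-hand side the coefficients up to z^n determine the coefficient of
  z^(n+1).\<close>

definition causal :: "('a::zero fps \<Rightarrow> 'a fps \<Rightarrow> 'a fps) \<Rightarrow> bool" where
  "causal \<Phi> \<longleftrightarrow> (\<forall>n u u' v v'. agree_upto n u u' \<longrightarrow> agree_upto n v v' \<longrightarrow>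
     agree_upto n (\<Phi> u v) (\<Phi> u' v'))"

lemma fps_ivp_unique:
  fixes u v u' v' :: "'a::field_char_0 fps"
  assumes "causal \<Phi>" "causal \<Psi>"
    and "fps_deriv u = \<Phi> u v" "fps_deriv v = \<Psi> u v"
    and "fps_deriv u' = \<Phi> u' v'" "fps_deriv v' = \<Psi> u' v'"
    and "u $ 0 = u' $ 0" "v $ 0 = v' $ 0"
  shows "u = u' \<and> v = v'"
proof -
  \<comment> \<open>Here one divides by n + 1, which is possible in characteristic zero.\<close>
  have step: "x $ Suc n = y $ Suc n"
    if "fps_deriv x $ n = fps_deriv y $ n" for x y :: "'a fps" and n
    using that by (simp del: of_nat_Suc)
  have "agree_upto n u u' \<and> agree_upto n v v'" for n
  proof (induction n)
    case 0
    then show ?case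
      using assms(7,8) by (simp add: agree_upto_def)
  next
    case (Suc n)
    then have "agree_upto n (fps_deriv u) (fps_deriv u')" "agree_upto n (fps_deriv v) (fps_deriv v')"
      using assms(1-6) by (auto simp: causal_def)
    then have "u $ Suc n = u' $ Suc n" "v $ Suc n = v' $ Suc n"
      using step unfolding agree_upto_def by blast+
    then show ?case
      using Suc by (auto simp: agree_upto_def le_Suc_eq)
  qed
  then show ?thesis
    by (auto simp: agree_upto_def fps_eq_iff)
qed

text \<open>Picard iteration in the z-adic metric. Integration makes \<open>T\<close> gain one order
  of agreement, so the coefficient of z^n no longer changes from the n-th iterate on, and the limit
  is read off the diagonal.\<close>

lemma fps_ivp_exists:
  fixes \<Phi> \<Psi> :: "'a::field_char_0 fps \<Rightarrow> 'a fps \<Rightarrow> 'a fps"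
  assumes "causal \<Phi>" "causal \<Psi>"
  shows "\<exists>u v. fps_deriv u = \<Phi> u v \<and> fps_deriv v = \<Psi> u v \<and> u $ 0 = a \<and> v $ 0 = b"
proof -
  define T where "T = (\<lambda>(u, v). (fps_integral (\<Phi> u v) a, fps_integral (\<Psi> u v) b))"
  define S where "S n = (T ^^ n) (fps_const a, fps_const b)" for n
  have S_Suc: "S (Suc n) = T (S n)" for n
    by (simp add: S_def)
  have int: "agree_upto (Suc n) (fps_integral x c) (fps_integral y c)"
    if "agree_upto n x y" for n c and x y :: "'a fps"
    using that by (auto simp: agree_upto_def fps_integral_def)
  have T_step: "agree_upto (Suc n) (fst (T s)) (fst (T s')) \<and> agree_upto (Suc n) (snd (T s)) (snd (T s'))"
    if "agree_upto n (fst s) (fst s')" "agree_upto n (snd s) (snd s')" for n s s'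
    using that assms by (simp add: T_def case_prod_unfold causal_def int)
  have step: "agree_upto n (fst (S n)) (fst (S (Suc n))) \<and> agree_upto n (snd (S n)) (snd (S (Suc n)))" for n
  proof (induction n)
    case 0
    show ?case
      by (simp add: S_def T_def agree_upto_def fps_integral_def)
  next
    case (Suc n)
    then show ?case
      using T_step[of n "S n" "S (Suc n)"] by (simp add: S_Suc)
  qed
  have stable: "agree_upto n (fst (S n)) (fst (S (n + k))) \<and> agree_upto n (snd (S n)) (snd (S (n + k)))" for n k
  proof (induction k)
    case (Suc k)
    then show ?case
      using step[of "n + k"] by (auto simp: agree_upto_def)
  qed (simp add: agree_upto_refl)
  define u where "u = Abs_fps (\<lambda>n. fst (S n) $ n)"
  define v where "v = Abs_fps (\<lambda>n. snd (S n) $ n)"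
  have uv: "agree_upto n u (fst (S n))" "agree_upto n v (snd (S n))" for n
  proof -
    have "u $ k = fst (S n) $ k \<and> v $ k = snd (S n) $ k" if "k \<le> n" for k
      using stable[of k "n - k"] that by (simp add: agree_upto_def u_def v_def)
    then show "agree_upto n u (fst (S n))" "agree_upto n v (snd (S n))"
      by (auto simp: agree_upto_def)
  qed
  have "agree_upto n u (fps_integral (\<Phi> u v) a)" "agree_upto n v (fps_integral (\<Psi> u v) b)" for n
  proof -
    have "agree_upto (Suc n) (fps_integral (\<Phi> u v) a) (fst (S (Suc n)))"
         "agree_upto (Suc n) (fps_integral (\<Psi> u v) b) (snd (S (Suc n)))"
      using uv[of n] T_step[of n "(u, v)" "S n"] by (simp_all add: S_Suc T_def)
    then show "agree_upto n u (fps_integral (\<Phi> u v) a)" "agree_upto n v (fps_integral (\<Psi> u v) b)"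
      using uv[of "Suc n"] by (auto simp: agree_upto_def)
  qed
  then have eq: "u = fps_integral (\<Phi> u v) a" "v = fps_integral (\<Psi> u v) b"
    by (auto simp: agree_upto_def fps_eq_iff)
  have "fps_deriv u = \<Phi> u v" "fps_deriv v = \<Psi> u v"
    by (metis eq(1) fps_deriv_fps_integral, metis eq(2) fps_deriv_fps_integral)
  moreover have "u $ 0 = a" "v $ 0 = b"
    by (simp_all add: u_def v_def S_def)
  ultimately show ?thesis
    by blast
qed

subsection \<open>Weighted homogeneous power series\<close>

text \<open>Weighted homogeneity jointly in z and g, cut off at order n so that it can be proved by
  induction on the order. \<open>U\<close> is a family over all parameters because polynomial
  dependence on g is a property of the whole family.\<close>

definition weighted_upto ::
    "nat \<Rightarrow> nat \<Rightarrow> rat \<Rightarrow> (complex \<times> complex \<Rightarrow> complex fps) \<Rightarrow> bool" where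
  "weighted_upto p n w U \<longleftrightarrow>
     (\<forall>k\<le>n. rational_weighted_poly p (w - of_nat k * wt_z p) (\<lambda>g. U g $ k))"

lemma weighted_upto_add:
  "weighted_upto p n w U \<Longrightarrow> weighted_upto p n w V \<Longrightarrow> weighted_upto p n w (\<lambda>g. U g + V g)"
  by (simp add: weighted_upto_def rational_weighted_poly_add)

lemma weighted_upto_uminus:
  "weighted_upto p n w U \<Longrightarrow> weighted_upto p n w (\<lambda>g. - U g)"
  by (simp add: weighted_upto_def rational_weighted_poly_uminus)

lemma weighted_upto_diff:
  assumes "weighted_upto p n w U" "weighted_upto p n w V"
  shows "weighted_upto p n w (\<lambda>g. U g - V g)"
  using weighted_upto_add[OF assms(1) weighted_upto_uminus[OF assms(2)]] by simp

lemma weighted_upto_mult: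
  assumes "weighted_upto p n w U" "weighted_upto p n w' V"
  shows "weighted_upto p n (w + w') (\<lambda>g. U g * V g)"
  unfolding weighted_upto_def fps_mult_nth
proof (intro allI impI rational_weighted_poly_sum)
  fix k i :: nat
  assume "k \<le> n" "i \<in> {0..k}"
  then have "rational_weighted_poly p ((w - of_nat i * wt_z p) + (w' - of_nat (k - i) * wt_z p))
      (\<lambda>g. U g $ i * V g $ (k - i))"
    using assms unfolding weighted_upto_def
    by (intro rational_weighted_poly_mult) (simp_all del: of_nat_diff)
  moreover have "(w - of_nat i * wt_z p) + (w' - of_nat (k - i) * wt_z p) = w + w' - of_nat k * wt_z p"
    using \<open>i \<in> {0..k}\<close> by (simp add: of_nat_diff algebra_simps)
  ultimately show "rational_weighted_poly p (w + w' - of_nat k * wt_z p) (\<lambda>g. U g $ i * V g $ (k - i))"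
    by (simp only:)
qed

lemma weighted_upto_fps_const:
  assumes "rational_weighted_poly p w f"
  shows "weighted_upto p n w (\<lambda>g. fps_const (f g))"
  unfolding weighted_upto_def
proof (intro allI impI)
  fix k
  show "rational_weighted_poly p (w - of_nat k * wt_z p) (\<lambda>g. fps_const (f g) $ k)"
    using assms by (cases "k = 0") (auto simp: rational_weighted_poly_zero)
qed

lemma weighted_upto_of_rat: "weighted_upto p n 0 (\<lambda>g. fps_const (of_rat c))"
  by (intro weighted_upto_fps_const rational_weighted_poly_const)

lemma weighted_upto_numeral: "weighted_upto p n 0 (\<lambda>g. numeral k)"
  using weighted_upto_of_rat[of p n "numeral k"] by (simp add: numeral_fps_const)

lemma weighted_upto_one: "weighted_upto p n 0 (\<lambda>g. 1)"
  using weighted_upto_of_rat[of p n 1] by simp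

lemma weighted_upto_power:
  assumes "weighted_upto p n w U"
  shows "weighted_upto p n (of_nat k * w) (\<lambda>g. U g ^ k)"
proof (induction k)
  case (Suc k)
  show ?case
    using weighted_upto_mult[OF assms Suc] by (simp add: algebra_simps)
qed (simp add: weighted_upto_one)

lemma weighted_upto_gs: "weighted_upto p n (wt_gs p) (\<lambda>g. fps_const (fst g))"
  using rational_weighted_poly_monomial[of 1 p 0 _ 1] by (intro weighted_upto_fps_const) simp

lemma weighted_upto_weight:
  "weighted_upto p n w U \<Longrightarrow> w = w' \<Longrightarrow> weighted_upto p n w' U"
  by simp

lemma weighted_upto_shift:
  assumes "\<And>n. weighted_upto p n w U"
  shows "weighted_upto p n (w - of_nat k * wt_z p) (\<lambda>g. fps_shift k (U g))"
  unfolding weighted_upto_def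
proof (intro allI impI)
  fix i
  show "rational_weighted_poly p (w - of_nat k * wt_z p - of_nat i * wt_z p)
      (\<lambda>g. fps_shift k (U g) $ i)"
    using assms[of "i + k"] by (auto simp: weighted_upto_def algebra_simps)
qed

text \<open>The recursion for the coefficients of an inverse divides by the constant term only. As
  this is a rational number independent of g, polynomials in g stay polynomials.\<close>

lemma weighted_upto_inverse:
  assumes W: "\<And>n. weighted_upto p n 0 W" and c: "\<And>g. W g $ 0 = of_rat c" and "c \<noteq> 0"
  shows "weighted_upto p n 0 (\<lambda>g. inverse (W g))"
  unfolding weighted_upto_def
proof (intro allI impI)
  fix k
  have W': "rational_weighted_poly p (- (of_nat k * wt_z p)) (\<lambda>g. W g $ k)" for k
    using W[of k] by (auto simp: weighted_upto_def)
  show "rational_weighted_poly p (0 - of_nat k * wt_z p) (\<lambda>g. inverse (W g) $ k)"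
  proof (induction k rule: less_induct)
    case (less k)
    show ?case
    proof (cases "k = 0")
      case True
      then show ?thesis
        using rational_weighted_poly_const[of p "inverse c"] by (simp add: c of_rat_inverse)
    next
      case False
      have rec: "inverse (W g) $ k =
          of_rat (- inverse c) * (\<Sum>i=1..k. W g $ i * inverse (W g) $ (k - i))" for g
      proof -
        have "(W g * inverse (W g)) $ k = 0"
          using False \<open>c \<noteq> 0\<close> by (subst inverse_mult_eq_1') (simp_all add: c)
        then have "W g $ 0 * inverse (W g) $ k + (\<Sum>i=1..k. W g $ i * inverse (W g) $ (k - i)) = 0"
          unfolding fps_mult_nth by (subst (asm) sum.atLeast_Suc_atMost) auto
        then show ?thesis
          using \<open>c \<noteq> 0\<close> nonzero_of_rat_inverse[OF \<open>c \<noteq> 0\<close>, where ?'a = complex]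
          by (simp only: c of_rat_minus) (simp add: field_simps add_eq_0_iff)
      qed
      have "rational_weighted_poly p (- (of_nat i * wt_z p) + (0 - of_nat (k - i) * wt_z p))
          (\<lambda>g. W g $ i * inverse (W g) $ (k - i))" if "i \<in> {1..k}" for i
        using that by (intro rational_weighted_poly_mult W' less.IH) auto
      moreover have "- (of_nat i * wt_z p) + (0 - of_nat (k - i) * wt_z p) = 0 - of_nat k * wt_z p"
        if "i \<in> {1..k}" for i
        using that by (simp add: of_nat_diff algebra_simps)
      ultimately have "rational_weighted_poly p (0 - of_nat k * wt_z p)
          (\<lambda>g. W g $ i * inverse (W g) $ (k - i))" if "i \<in> {1..k}" for i
        using that by metis
      then show ?thesis
        unfolding rec by (intro rational_weighted_poly_cmult rational_weighted_poly_sum)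
    qed
  qed
qed

text \<open>Differentiation in z shifts the weight by \<open>- wt_z p\<close>, hence the weights
  demanded of the right-hand sides. Each step passes from order n to n + 1 and divides by n + 1,
  which preserves rationality.\<close>

lemma weighted_ivp:
  assumes "\<And>g. fps_deriv (U g) = \<Phi> g (U g) (V g)" "\<And>g. fps_deriv (V g) = \<Psi> g (U g) (V g)"
    and "rational_weighted_poly p w (\<lambda>g. U g $ 0)" "rational_weighted_poly p w' (\<lambda>g. V g $ 0)"
    and \<Phi>: "\<And>n. weighted_upto p n w U \<Longrightarrow> weighted_upto p n w' V \<Longrightarrow>
          weighted_upto p n (w - wt_z p) (\<lambda>g. \<Phi> g (U g) (V g))"
    and \<Psi>: "\<And>n. weighted_upto p n w U \<Longrightarrow> weighted_upto p n w' V \<Longrightarrow>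
          weighted_upto p n (w' - wt_z p) (\<lambda>g. \<Psi> g (U g) (V g))"
  shows "weighted_upto p n w U \<and> weighted_upto p n w' V"
proof (induction n)
  case 0
  then show ?case
    using assms(3,4) by (simp add: weighted_upto_def)
next
  case (Suc n)
  have step: "weighted_upto p (Suc n) v W"
    if W: "weighted_upto p n v W"
      and D: "weighted_upto p n (v - wt_z p) (\<lambda>g. fps_deriv (W g))" for v W
  proof -
    have "rational_weighted_poly p (v - wt_z p - of_nat n * wt_z p) (\<lambda>g. fps_deriv (W g) $ n)"
      using D by (auto simp: weighted_upto_def)
    then have "rational_weighted_poly p (v - of_nat (Suc n) * wt_z p)
        (\<lambda>g. of_rat (1 / of_nat (Suc n)) * fps_deriv (W g) $ n)"
      by (intro rational_weighted_poly_cmult) (simp add: algebra_simps)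
    moreover have "(\<lambda>g. of_rat (1 / of_nat (Suc n)) * fps_deriv (W g) $ n) = (\<lambda>g. W g $ Suc n)"
      by (simp add: of_rat_divide del: of_nat_Suc)
    ultimately have "rational_weighted_poly p (v - of_nat (Suc n) * wt_z p) (\<lambda>g. W g $ Suc n)"
      by (simp only:)
    then show ?thesis
      using W unfolding weighted_upto_def le_Suc_eq by blast
  qed
  have "weighted_upto p (Suc n) w U"
    using Suc \<Phi>[of n] assms(1) by (intro step) auto
  moreover have "weighted_upto p (Suc n) w' V"
    using Suc \<Psi>[of n] assms(2) by (intro step) auto
  ultimately show ?case
    by blast
qed


subsection \<open>Charts at infinity\<close>

text \<open>The part of \<open>F\<close> free of x and y, with sign + for p = 3 and - otherwise. It
  has weight 1 in all cases, and the charts see g_l only through it.\<close>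

definition energy :: "nat \<Rightarrow> complex \<times> complex \<Rightarrow> complex" where
  "energy p g = (if p = 3 then snd g else if p = 4 then snd g + (fst g)^2 / 8 else snd g + 2 * (fst g)^3)"

text \<open>
  The chart coordinates \<open>(u, v)\<close> are \<open>(x/y, 1/y)\<close>, \<open>(1/x, y/x\<^sup>2)\<close>, \<open>(1/y, x/y)\<close> for \<open>p = 3, 4, 6\<close>.
  The equation \<open>F = 0\<close> becomes \<open>H = 0\<close> with \<open>H = chart_ham\<close>, and on \<open>H = 0\<close> the system becomes
  \<open>(u', v') = (- H\<^sub>v, H\<^sub>u)\<close> for \<open>p = 3, 4\<close> and \<open>(u', v') = (H\<^sub>v, - H\<^sub>u)\<close> for \<open>p = 6\<close>.
  The parameters are \<open>s = g\<^sub>s\<close> and the constant term \<open>e\<close> of \<open>F\<close> up to sign.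
\<close>

definition chart_ham :: "nat \<Rightarrow> 'a::comm_ring_1 \<Rightarrow> 'a \<Rightarrow> 'a \<Rightarrow> 'a \<Rightarrow> 'a" where
  "chart_ham p s e u v = (
     if p = 3 then v - 4 * u^3 + s * u * v^2 + e * v^3
     else if p = 4 then v^2 - 1 + s * u^2 - e * u^4
     else v - v^3 + s * u * (3 * v^2 + 1) - e * u^3)"

definition chart_du :: "nat \<Rightarrow> 'a::comm_ring_1 \<Rightarrow> 'a \<Rightarrow> 'a \<Rightarrow> 'a \<Rightarrow> 'a" where
  "chart_du p s e u v = (
     if p = 3 then - 1 - 2 * s * u * v - 3 * e * v^2
     else if p = 4 then - 2 * v
     else 1 - 3 * v^2 + 6 * s * u * v)"

definition chart_dv :: "nat \<Rightarrow> 'a::comm_ring_1 \<Rightarrow> 'a \<Rightarrow> 'a \<Rightarrow> 'a \<Rightarrow> 'a" where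
  "chart_dv p s e u v = (
     if p = 3 then s * v^2 - 12 * u^2
     else if p = 4 then 2 * s * u - 4 * e * u^3
     else 3 * e * u^2 - s - 3 * s * v^2)"

definition chart_x :: "nat \<Rightarrow> 'a::field \<Rightarrow> 'a \<Rightarrow> 'a" where
  "chart_x p u v = (if p = 3 then u / v else if p = 4 then 1 / u else v / u)"

definition chart_y :: "nat \<Rightarrow> 'a::field \<Rightarrow> 'a \<Rightarrow> 'a" where
  "chart_y p u v = (if p = 3 then 1 / v else if p = 4 then v / u^2 else 1 / u)"

text \<open>The values of v at the points at infinity, all of which lie in the chart and on u = 0.
  For p = 4, 6 they are exactly the roots of \<open>chart_ham p s e 0 v\<close>. For p = 3 infinity
  is v = 0, and u = 0 also contains the affine points with x = 0, where e v^2 = -1; hence the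
  exclusion of p = 3 in \<open>chart_inits_if_ham\<close>.\<close>

definition chart_inits :: "nat \<Rightarrow> 'a::field set" where
  "chart_inits p = (if p = 3 then {0} else if p = 4 then {1, -1} else {0, 1, -1})"

definition chart_solution :: "nat \<Rightarrow> complex \<times> complex \<Rightarrow> complex fps \<Rightarrow> complex fps \<Rightarrow> bool" where
  "chart_solution p g u v \<longleftrightarrow>
     fps_deriv u = chart_du p (fps_const (fst g)) (fps_const (energy p g)) u v \<and>
     fps_deriv v = chart_dv p (fps_const (fst g)) (fps_const (energy p g)) u v \<and>
     u $ 0 = 0 \<and> v $ 0 \<in> chart_inits p \<and>
     chart_ham p (fps_const (fst g)) (fps_const (energy p g)) u v = 0"

text \<open>What a formal solution satisfies at a single parameter where it has a pole. Holomorphy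
  and weights, which relate different parameters, are treated separately.\<close>

definition polar_solution :: "nat \<Rightarrow> complex \<times> complex \<Rightarrow> complex fls \<Rightarrow> complex fls \<Rightarrow> bool" where
  "polar_solution p g X Y \<longleftrightarrow>
     fls_deriv X = dF_dy p X Y (const_param g) \<and>
     fls_deriv Y = - dF_dx p X Y (const_param g) \<and>
     F p X Y (const_param g) = 0 \<and>
     (\<exists>n<0. X $$ n \<noteq> 0 \<or> Y $$ n \<noteq> 0)"

lemma fps_to_fls_chart:
  fixes u v :: "complex fps"
  shows "fps_to_fls (chart_du p (fps_const s) (fps_const e) u v) =
           chart_du p (fls_const s) (fls_const e) (fps_to_fls u) (fps_to_fls v)"
    and "fps_to_fls (chart_dv p (fps_const s) (fps_const e) u v) =
           chart_dv p (fls_const s) (fls_const e) (fps_to_fls u) (fps_to_fls v)"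
    and "fps_to_fls (chart_ham p (fps_const s) (fps_const e) u v) =
           chart_ham p (fls_const s) (fls_const e) (fps_to_fls u) (fps_to_fls v)"
  by (simp_all add: chart_du_def chart_dv_def chart_ham_def fls_times_fps_to_fls fps_to_fls_power)

text \<open>Chart solutions are power series, but returning to x and y requires division; so their
  equations are moved to the field of Laurent series.\<close>

lemma chart_solution_fls_iff:
  "chart_solution p g u v \<longleftrightarrow>
     fls_deriv (fps_to_fls u) =
       chart_du p (fls_const (fst g)) (fls_const (energy p g)) (fps_to_fls u) (fps_to_fls v) \<and>
     fls_deriv (fps_to_fls v) =
       chart_dv p (fls_const (fst g)) (fls_const (energy p g)) (fps_to_fls u) (fps_to_fls v) \<and>
     u $ 0 = 0 \<and> v $ 0 \<in> chart_inits p \<and>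
     chart_ham p (fls_const (fst g)) (fls_const (energy p g)) (fps_to_fls u) (fps_to_fls v) = 0"
  unfolding chart_solution_def
  by (simp flip: fps_to_fls_chart fls_deriv_fps_to_fls)
    (simp add: fls_deriv_fps_to_fls)

lemma chart_ham_inits:
  fixes v :: "'a::field"
  assumes "v \<in> chart_inits p"
  shows "chart_ham p s e 0 v = 0"
  using assms by (auto simp: chart_inits_def chart_ham_def split: if_splits)

lemma chart_inits_if_ham:
  fixes u v :: "complex fps"
  assumes "p \<noteq> 3" "u $ 0 = 0"
    and "chart_ham p (fls_const s) (fls_const e) (fps_to_fls u) (fps_to_fls v) = 0"
  shows "v $ 0 \<in> chart_inits p"
proof -
  define a where "a = v $ 0"
  have "chart_ham p (fps_const s) (fps_const e) u v = 0"
    using assms(3) by (simp flip: fps_to_fls_chart)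
  moreover have "chart_ham p (fps_const s) (fps_const e) u v $ 0 = chart_ham p s e 0 a"
    using assms(2) by (simp add: chart_ham_def fps_power_zeroth a_def)
  ultimately have "chart_ham p s e 0 a = 0"
    by simp
  moreover have "a^2 = 1" if "a = a^3" "a \<noteq> 0"
    using that by (simp add: power2_eq_square power3_eq_cube)
  ultimately show ?thesis
    using assms(1) power2_eq_1_iff[of a]
    by (auto simp: chart_inits_def chart_ham_def a_def[symmetric] split: if_splits)
qed

lemma fls_const_energy:
  "fls_const (energy p g) = (if p = 3 then fls_const (snd g)
     else if p = 4 then fls_const (snd g) + (fls_const (fst g))^2 / 8
     else fls_const (snd g) + 2 * (fls_const (fst g))^3)"
  by (simp add: energy_def fls_const_power
    flip: fls_plus_const fls_const_divide_const fls_const_mult_const)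

section \<open>From polar Laurent solutions to power series in the charts\<close>

lemma polar_solution_iff:
  defines "s \<equiv> \<lambda>g. fls_const (fst g)" and "e \<equiv> \<lambda>p g. fls_const (energy p g)"
  shows
   "polar_solution 3 g X Y \<longleftrightarrow>
      fls_deriv X = 2 * Y \<and> fls_deriv Y = 12 * X^2 - s g \<and> Y^2 = 4 * X^3 - s g * X - e 3 g \<and>
      (\<exists>n<0. X $$ n \<noteq> 0 \<or> Y $$ n \<noteq> 0)"
   "polar_solution 4 g X Y \<longleftrightarrow>
      fls_deriv X = 2 * Y \<and> fls_deriv Y = 4 * X^3 - 2 * s g * X \<and> Y^2 = X^4 - s g * X^2 + e 4 g \<and>
      (\<exists>n<0. X $$ n \<noteq> 0 \<or> Y $$ n \<noteq> 0)"
   "polar_solution 6 g X Y \<longleftrightarrow>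
      fls_deriv X = 2 * X * Y + 2 * s g * Y \<and> fls_deriv Y = 3 * X^2 - Y^2 - 6 * s g * X \<and>
      X * (Y^2 - X^2) + s g * (3 * X^2 + Y^2) = e 6 g \<and>
      (\<exists>n<0. X $$ n \<noteq> 0 \<or> Y $$ n \<noteq> 0)"
  unfolding polar_solution_def s_def e_def fls_const_energy
  by (auto simp: dF_dx_def dF_dy_def F_def const_param_def algebra_simps)

text \<open>Power series form a valuation ring: a Laurent series or its inverse belongs to it. In
  the chart lemmas below, the wrong alternative is refuted by clearing denominators in F = 0 and
  comparing constant terms.\<close>

lemma fls_regular_or_pole:
  fixes f :: "complex fls"
  obtains (regular) a where "f = fps_to_fls a" "\<And>n. n < 0 \<Longrightarrow> f $$ n = 0"
  | (pole) b where "f * fps_to_fls b = 1" "b $ 0 = 0"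
proof (cases "fls_subdegree f \<ge> 0")
  case True
  then show ?thesis
    using regular[of "fls_regpart f"] by simp
next
  case False
  then have pos: "fls_subdegree (inverse f) > 0" and "f \<noteq> 0"
    by auto
  then have "fps_to_fls (fls_regpart (inverse f)) = inverse f"
    by simp
  moreover have "fls_regpart (inverse f) $ 0 = 0"
    using pos by simp
  ultimately show ?thesis
    using pole[of "fls_regpart (inverse f)"] \<open>f \<noteq> 0\<close> by simp
qed

lemma fls_eq_imp_nth_0_eq:
  "fps_to_fls a = fps_to_fls b \<Longrightarrow> a $ 0 = b $ 0"
  by simp

lemma polar_solution_chart_3:
  assumes "polar_solution 3 g X Y"
  shows "\<exists>U V. chart_solution 3 g U V \<and> X = chart_x 3 (fps_to_fls U) (fps_to_fls V) \<and>
    Y = chart_y 3 (fps_to_fls U) (fps_to_fls V)"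
proof -
  define s where "s = fls_const (fst g)"
  define e where "e = fls_const (energy 3 g)"
  have X': "fls_deriv X = 2 * Y" and Y': "fls_deriv Y = 12 * X^2 - s"
    and F: "Y^2 = 4 * X^3 - s * X - e" and pole: "\<exists>n<0. X $$ n \<noteq> 0 \<or> Y $$ n \<noteq> 0"
    using assms by (auto simp: polar_solution_iff s_def e_def)
  have se: "s = fps_to_fls (fps_const (fst g))" "e = fps_to_fls (fps_const (energy 3 g))"
    by (simp_all add: s_def e_def)
  note hom = fls_times_fps_to_fls fps_to_fls_power
  \<comment> \<open>If y were regular, x would have a pole, and F = 0 multiplied by b^3 with b = 1/x
    would read 0 = 4 at z = 0.\<close>
  obtain V where V: "Y * fps_to_fls V = 1" "V $ 0 = 0"
  proof (cases Y rule: fls_regular_or_pole)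
    case (regular a)
    show ?thesis
    proof (cases X rule: fls_regular_or_pole)
      case (pole b)
      have "fps_to_fls a ^ 2 * fps_to_fls b ^ 3 = 4 - s * fps_to_fls b ^ 2 - e * fps_to_fls b ^ 3"
      proof -
        have "(4 * X^3 - s * X - e) * fps_to_fls b ^ 3 =
            4 * (X * fps_to_fls b) ^ 3 - s * (X * fps_to_fls b) * fps_to_fls b ^ 2 - e * fps_to_fls b ^ 3"
          by (simp add: power_mult_distrib power2_eq_square power3_eq_cube algebra_simps)
        then show ?thesis
          using F by (simp add: pole(1) regular(1))
      qed
      then have "fps_to_fls (a ^ 2 * b ^ 3) =
          fps_to_fls (4 - fps_const (fst g) * b ^ 2 - fps_const (energy 3 g) * b ^ 3)"
        by (simp add: hom se)
      from fls_eq_imp_nth_0_eq[OF this] show ?thesis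
        using pole(2) by (simp add: fps_power_zeroth)
    next
      case (regular a')
      then show ?thesis
        using \<open>\<And>n. n < 0 \<Longrightarrow> Y $$ n = 0\<close> pole by auto
    qed
  next
    case (pole b)
    then show ?thesis
      using that by blast
  qed
  define v where "v = fps_to_fls V"
  have vY: "Y * v = 1"
    using V by (simp add: v_def)
  \<comment> \<open>F = 0 divided by y^3 is an equation between v and x/y. If x/y is regular, its
    constant term a satisfies 0 = 4 a^3; if x/y had a pole with inverse b, multiplication by b^3
    would give 0 = 4.\<close>
  obtain U where U: "X * v = fps_to_fls U" "U $ 0 = 0"
  proof (cases "X * v" rule: fls_regular_or_pole)
    case (regular a)
    have "v = 4 * (X * v)^3 - s * (X * v) * v^2 - e * v^3"
      using F vY by Groebner_Basis.algebra
    then have "fps_to_fls V =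
        fps_to_fls (4 * a^3 - fps_const (fst g) * a * V^2 - fps_const (energy 3 g) * V^3)"
      unfolding regular(1) by (simp add: hom se v_def)
    from fls_eq_imp_nth_0_eq[OF this] have "a $ 0 = 0"
      using V(2) by (simp add: fps_power_zeroth)
    then show ?thesis
      using regular that by blast
  next
    case (pole b)
    have "v * fps_to_fls b ^ 3 = 4 - s * fps_to_fls b ^ 2 * v^2 - e * v^3 * fps_to_fls b ^ 3"
      using F vY pole(1) by Groebner_Basis.algebra
    then have "fps_to_fls (V * b ^ 3) =
        fps_to_fls (4 - fps_const (fst g) * b ^ 2 * V^2 - fps_const (energy 3 g) * V^3 * b ^ 3)"
      by (simp add: hom se v_def)
    from fls_eq_imp_nth_0_eq[OF this] show ?thesis
      using pole(2) V(2) by (simp add: fps_power_zeroth)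
  qed
  define u where "u = fps_to_fls U"
  have X: "X = u * Y"
  proof -
    have "X * v * Y = X * (Y * v)"
      by (simp add: mult_ac)
    then show ?thesis
      by (simp add: U(1) vY u_def)
  qed
  have "v \<noteq> 0"
    using vY by auto
  have "chart_solution 3 g U V"
    unfolding chart_solution_fls_iff s_def[symmetric] e_def[symmetric] u_def[symmetric] v_def[symmetric]
  proof (intro conjI)
    \<comment> \<open>The product rule for X = u Y. Multiplication by v = 1/Y isolates u', and F = 0
      brings it into the form of \<open>chart_du\<close>.\<close>
    have "fls_deriv u * Y + u * (12 * X^2 - s) = 2 * Y"
      using X' by (simp add: X Y' add.commute)
    then show "fls_deriv u = chart_du 3 s e u v"
      using X vY F unfolding chart_du_def by simp Groebner_Basis.algebra
    have "fls_deriv (Y * v) = 0"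
      by (simp add: vY)
    then have "fls_deriv v * Y + v * (12 * X^2 - s) = 0"
      by (simp add: Y' algebra_simps)
    then show "fls_deriv v = chart_dv 3 s e u v"
      using X vY F unfolding chart_dv_def by simp Groebner_Basis.algebra
    show "chart_ham 3 s e u v = 0"
      using X vY F unfolding chart_ham_def by simp Groebner_Basis.algebra
  qed (simp_all add: U V chart_inits_def)
  moreover have "X = chart_x 3 u v" "Y = chart_y 3 u v"
    using X vY \<open>v \<noteq> 0\<close> by (simp_all add: chart_x_def chart_y_def field_simps)
  ultimately show ?thesis
    unfolding u_def v_def by blast
qed

text \<open>As y^2 is a polynomial in x, a pole of y forces one of x. With u = 1/x regular, v =
  y/x^2 satisfies v^2 = 1 - s u^2 + e u^4, so it cannot have a pole either.\<close>

lemma polar_solution_chart_4: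
  assumes "polar_solution 4 g X Y"
  shows "\<exists>U V. chart_solution 4 g U V \<and> X = chart_x 4 (fps_to_fls U) (fps_to_fls V) \<and>
    Y = chart_y 4 (fps_to_fls U) (fps_to_fls V)"
proof -
  define s where "s = fls_const (fst g)"
  define e where "e = fls_const (energy 4 g)"
  have X': "fls_deriv X = 2 * Y" and Y': "fls_deriv Y = 4 * X^3 - 2 * s * X"
    and F: "Y^2 = X^4 - s * X^2 + e" and pole: "\<exists>n<0. X $$ n \<noteq> 0 \<or> Y $$ n \<noteq> 0"
    using assms by (auto simp: polar_solution_iff s_def e_def)
  have se: "s = fps_to_fls (fps_const (fst g))" "e = fps_to_fls (fps_const (energy 4 g))"
    by (simp_all add: s_def e_def)
  note hom = fls_times_fps_to_fls fps_to_fls_power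
  obtain U where U: "X * fps_to_fls U = 1" "U $ 0 = 0"
  proof (cases X rule: fls_regular_or_pole)
    case (regular a)
    show ?thesis
    proof (cases Y rule: fls_regular_or_pole)
      case (pole b)
      have "1 = (fps_to_fls a ^ 4 - s * fps_to_fls a ^ 2 + e) * fps_to_fls b ^ 2"
      proof -
        have "(Y * fps_to_fls b)^2 = Y^2 * fps_to_fls b ^ 2"
          by (simp add: power_mult_distrib power2_eq_square power3_eq_cube algebra_simps)
        then show ?thesis
          using F by (simp add: pole(1) regular(1))
      qed
      then have "fps_to_fls 1 =
          fps_to_fls ((a ^ 4 - fps_const (fst g) * a ^ 2 + fps_const (energy 4 g)) * b ^ 2)"
        by (simp add: hom se)
      from fls_eq_imp_nth_0_eq[OF this] show ?thesis
        using pole(2) by (simp add: fps_power_zeroth)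
    next
      case (regular a')
      then show ?thesis
        using \<open>\<And>n. n < 0 \<Longrightarrow> X $$ n = 0\<close> pole by auto
    qed
  next
    case (pole b)
    then show ?thesis
      using that by blast
  qed
  define u where "u = fps_to_fls U"
  have uX: "X * u = 1"
    using U by (simp add: u_def)
  have ham: "(Y * u^2)^2 = 1 - s * u^2 + e * u^4"
    using F uX by Groebner_Basis.algebra
  obtain V where V: "Y * u^2 = fps_to_fls V"
  proof (cases "Y * u^2" rule: fls_regular_or_pole)
    case (pole b)
    have "1 = fps_to_fls b ^ 2 * (1 - s * u^2 + e * u^4)"
      using ham pole(1) by Groebner_Basis.algebra
    then have "fps_to_fls 1 =
        fps_to_fls (b ^ 2 * (1 - fps_const (fst g) * U^2 + fps_const (energy 4 g) * U^4))"
      by (simp add: hom se u_def)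
    from fls_eq_imp_nth_0_eq[OF this] show ?thesis
      using pole(2) by (simp add: fps_power_zeroth)
  qed blast
  define v where "v = fps_to_fls V"
  have Y: "Y = v * X^2"
  proof -
    have "Y * u^2 * X^2 = Y * (X * u)^2"
      by (simp add: power_mult_distrib)
    then show ?thesis
      by (simp add: V uX v_def)
  qed
  have "u \<noteq> 0"
    using uX by auto
  have "fls_deriv (X * u) = 0"
    by (simp add: uX)
  then have du: "fls_deriv u * X + u * (2 * Y) = 0"
    by (simp add: X' algebra_simps)
  have "chart_solution 4 g U V"
    unfolding chart_solution_fls_iff s_def[symmetric] e_def[symmetric] u_def[symmetric] v_def[symmetric]
  proof (intro conjI)
    show ham_0: "chart_ham 4 s e u v = 0"
      using V ham unfolding chart_ham_def v_def by simp
    show "V $ 0 \<in> chart_inits 4"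
      using chart_inits_if_ham[OF _ U(2) ham_0[unfolded u_def v_def s_def e_def]] by simp
    show "fls_deriv u = chart_du 4 s e u v"
      using Y uX du unfolding chart_du_def by simp Groebner_Basis.algebra
    have "4 * X^3 - 2 * s * X = fls_deriv v * X^2 + v * (2 * X * (2 * Y))"
      using Y' by (simp add: Y X' power2_eq_square algebra_simps)
    then show "fls_deriv v = chart_dv 4 s e u v"
      using Y uX F unfolding chart_dv_def by simp Groebner_Basis.algebra
  qed (fact U)
  moreover have "X = chart_x 4 u v" "Y = chart_y 4 u v"
    using Y uX \<open>u \<noteq> 0\<close> V unfolding v_def by (simp_all add: chart_x_def chart_y_def field_simps)
  ultimately show ?thesis
    unfolding u_def v_def by blast
qed

text \<open>The top form x (y^2 - x^2) equals - x^3 on y = 0, so x cannot dominate y: F = 0 divided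
  by x^3 would give 1 = 0 at z = 0. This excludes both a regular y and a pole of x/y.\<close>

lemma polar_solution_chart_6:
  assumes "polar_solution 6 g X Y"
  shows "\<exists>U V. chart_solution 6 g U V \<and> X = chart_x 6 (fps_to_fls U) (fps_to_fls V) \<and>
    Y = chart_y 6 (fps_to_fls U) (fps_to_fls V)"
proof -
  define s where "s = fls_const (fst g)"
  define e where "e = fls_const (energy 6 g)"
  have X': "fls_deriv X = 2 * X * Y + 2 * s * Y" and Y': "fls_deriv Y = 3 * X^2 - Y^2 - 6 * s * X"
    and F: "X * (Y^2 - X^2) + s * (3 * X^2 + Y^2) = e"
    and pole: "\<exists>n<0. X $$ n \<noteq> 0 \<or> Y $$ n \<noteq> 0"
    using assms by (auto simp: polar_solution_iff s_def e_def)
  have se: "s = fps_to_fls (fps_const (fst g))" "e = fps_to_fls (fps_const (energy 6 g))"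
    by (simp_all add: s_def e_def)
  note hom = fls_times_fps_to_fls fps_to_fls_power
  obtain U where U: "Y * fps_to_fls U = 1" "U $ 0 = 0"
  proof (cases Y rule: fls_regular_or_pole)
    case (regular a)
    show ?thesis
    proof (cases X rule: fls_regular_or_pole)
      case (pole b)
      have "1 = fps_to_fls b ^ 2 * fps_to_fls a ^ 2 +
          s * (3 * fps_to_fls b + fps_to_fls a ^ 2 * fps_to_fls b ^ 3) - e * fps_to_fls b ^ 3"
      proof -
        have "(X * (Y^2 - X^2) + s * (3 * X^2 + Y^2)) * fps_to_fls b ^ 3 =
            (X * fps_to_fls b) * (Y^2 * fps_to_fls b ^ 2 - (X * fps_to_fls b)^2) +
            s * (3 * (X * fps_to_fls b)^2 * fps_to_fls b + Y^2 * fps_to_fls b ^ 3)"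
          by (simp add: power_mult_distrib power2_eq_square power3_eq_cube algebra_simps)
        then show ?thesis
          unfolding F by (simp add: pole(1) regular(1) algebra_simps)
      qed
      then have "fps_to_fls 1 = fps_to_fls (b ^ 2 * a ^ 2 +
          fps_const (fst g) * (3 * b + a ^ 2 * b ^ 3) - fps_const (energy 6 g) * b ^ 3)"
        by (simp add: hom se)
      from fls_eq_imp_nth_0_eq[OF this] show ?thesis
        using pole(2) by (simp add: fps_power_zeroth)
    next
      case (regular a')
      then show ?thesis
        using \<open>\<And>n. n < 0 \<Longrightarrow> Y $$ n = 0\<close> pole by auto
    qed
  next
    case (pole b)
    then show ?thesis
      using that by blast
  qed
  define u where "u = fps_to_fls U"
  have uY: "Y * u = 1"
    using U by (simp add: u_def)
  obtain V where V: "X * u = fps_to_fls V"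
  proof (cases "X * u" rule: fls_regular_or_pole)
    case (pole b)
    have "1 = fps_to_fls b ^ 2 + s * u * (3 * fps_to_fls b + fps_to_fls b ^ 3) -
        e * u^3 * fps_to_fls b ^ 3"
    proof -
      \<comment> \<open>Since b is the inverse of x u, \<open>t\<close> is 1/x; multiplying F by t^3
        is the division by x^3.\<close>
      define t where "t = u * fps_to_fls b"
      have t: "X * t = 1" "Y * t = fps_to_fls b"
        using pole(1) uY by (simp_all add: t_def mult_ac)
      have "(X * (Y^2 - X^2) + s * (3 * X^2 + Y^2)) * t^3 =
          (X * t) * ((Y * t)^2 - (X * t)^2) + s * (3 * (X * t)^2 * t + (Y * t)^2 * t)"
        by Groebner_Basis.algebra
      then show ?thesis
        unfolding F t by (simp add: t_def power_mult_distrib power3_eq_cube power2_eq_square algebra_simps)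
    qed
    then have "fps_to_fls 1 = fps_to_fls (b ^ 2 +
        fps_const (fst g) * U * (3 * b + b ^ 3) - fps_const (energy 6 g) * U^3 * b ^ 3)"
      by (simp add: hom se u_def)
    from fls_eq_imp_nth_0_eq[OF this] show ?thesis
      using pole(2) U(2) by (simp add: fps_power_zeroth)
  qed blast
  define v where "v = fps_to_fls V"
  have X: "X = v * Y"
  proof -
    have "X * u * Y = X * (Y * u)"
      by (simp add: mult_ac)
    then show ?thesis
      by (simp add: V uY v_def)
  qed
  have "u \<noteq> 0"
    using uY by auto
  have "fls_deriv (Y * u) = 0"
    by (simp add: uY)
  then have du: "fls_deriv u * Y + u * (3 * X^2 - Y^2 - 6 * s * X) = 0"
    by (simp add: Y' algebra_simps)
  have "chart_solution 6 g U V"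
    unfolding chart_solution_fls_iff s_def[symmetric] e_def[symmetric] u_def[symmetric] v_def[symmetric]
  proof (intro conjI)
    show ham_0: "chart_ham 6 s e u v = 0"
      using X uY F unfolding chart_ham_def by simp Groebner_Basis.algebra
    show "V $ 0 \<in> chart_inits 6"
      using chart_inits_if_ham[OF _ U(2) ham_0[unfolded u_def v_def s_def e_def]] by simp
    show "fls_deriv u = chart_du 6 s e u v"
      using X uY du unfolding chart_du_def by simp Groebner_Basis.algebra
    have "2 * X * Y + 2 * s * Y = fls_deriv v * Y + v * (3 * X^2 - Y^2 - 6 * s * X)"
      using X' by (simp add: X Y' add.commute)
    then show "fls_deriv v = chart_dv 6 s e u v"
      using X uY F unfolding chart_dv_def by simp Groebner_Basis.algebra
  qed (fact U)
  moreover have "X = chart_x 6 u v" "Y = chart_y 6 u v"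
    using X uY \<open>u \<noteq> 0\<close> by (simp_all add: chart_x_def chart_y_def field_simps)
  ultimately show ?thesis
    unfolding u_def v_def by blast
qed


lemma polar_solution_chart:
  assumes "p \<in> {3, 4, 6}" "polar_solution p g X Y"
  obtains u v where "chart_solution p g u v"
    "X = chart_x p (fps_to_fls u) (fps_to_fls v)" "Y = chart_y p (fps_to_fls u) (fps_to_fls v)"
  using assms polar_solution_chart_3 polar_solution_chart_4 polar_solution_chart_6 by blast

section \<open>From chart solutions back to the original system\<close>

lemma eq_mult_inverse:
  fixes a b c d :: "'a::comm_monoid_mult"
  assumes "d * c = 1" "a * c = b"
  shows "a = b * d"
  using assms by (metis mult.assoc mult.commute mult_1_right)

lemma chart_equations_3:
  fixes u v s e :: "complex fls"
  assumes "fls_deriv u = chart_du 3 s e u v" "fls_deriv v = chart_dv 3 s e u v"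
    and "chart_ham 3 s e u v = 0" "v \<noteq> 0"
  defines "X \<equiv> chart_x 3 u v" and "Y \<equiv> chart_y 3 u v"
  shows "fls_deriv X = 2 * Y" "fls_deriv Y = 12 * X^2 - s" "Y^2 = 4 * X^3 - s * X - e"
proof -
  have Xv: "X * v = u" and Yv: "Y * v = 1"
    using \<open>v \<noteq> 0\<close> by (simp_all add: X_def Y_def chart_x_def chart_y_def)
  have ham: "v - 4 * u^3 + s * u * v^2 + e * v^3 = 0"
    using assms(3) by (simp add: chart_ham_def)
  have du: "fls_deriv X * v + X * fls_deriv v = fls_deriv u"
    by (simp flip: Xv add: add.commute)
  have dv: "fls_deriv Y * v + Y * fls_deriv v = 0"
    using arg_cong[OF Yv, of fls_deriv] by (simp add: add.commute)
  note D = assms(1,2)[unfolded chart_du_def chart_dv_def, simplified]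
  \<comment> \<open>The left-hand side is v^2 F, obtained from H = v^3 F by cancelling one factor v.
    In this form \<open>fls_deriv X * v\<close> is 2 minus three times it.\<close>
  have ham': "1 - 4 * X^3 * v^2 + s * X * v^2 + e * v^2 = 0"
  proof -
    have "v * (1 - 4 * X^3 * v^2 + s * X * v^2 + e * v^2) = 0"
      using ham unfolding Xv[symmetric] by Groebner_Basis.algebra
    then show ?thesis
      using \<open>v \<noteq> 0\<close> by simp
  qed
  have "fls_deriv X * v = 2"
    using du[unfolded D] ham' unfolding Xv[symmetric] by Groebner_Basis.algebra
  then show "fls_deriv X = 2 * Y"
    by (rule eq_mult_inverse[OF Yv])
  have X: "X = u * Y"
    by (rule eq_mult_inverse[OF Yv Xv])
  have "fls_deriv Y * v = - Y * fls_deriv v"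
    using dv by (simp add: eq_neg_iff_add_eq_0)
  then have "fls_deriv Y = - Y * (s * v^2 - 12 * u^2) * Y"
    unfolding D by (rule eq_mult_inverse[OF Yv])
  also have "\<dots> = 12 * X^2 - s * (Y * v)^2"
    unfolding X by Groebner_Basis.algebra
  finally show "fls_deriv Y = 12 * X^2 - s"
    by (simp add: Yv)
  have "Y^2 - 4 * X^3 * (Y * v)^2 + s * X * (Y * v)^2 + e * (Y * v)^2 =
      Y^2 * (1 - 4 * X^3 * v^2 + s * X * v^2 + e * v^2)"
    by Groebner_Basis.algebra
  then show "Y^2 = 4 * X^3 - s * X - e"
    unfolding ham' Yv by (simp add: algebra_simps)
qed

lemma chart_equations_4:
  fixes u v s e :: "complex fls"
  assumes "fls_deriv u = chart_du 4 s e u v" "fls_deriv v = chart_dv 4 s e u v"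
    and "chart_ham 4 s e u v = 0" "u \<noteq> 0"
  defines "X \<equiv> chart_x 4 u v" and "Y \<equiv> chart_y 4 u v"
  shows "fls_deriv X = 2 * Y" "fls_deriv Y = 4 * X^3 - 2 * s * X" "Y^2 = X^4 - s * X^2 + e"
proof -
  have Xu: "X * u = 1" and Yu: "Y * u^2 = v"
    using \<open>u \<noteq> 0\<close> by (simp_all add: X_def Y_def chart_x_def chart_y_def)
  have ham: "v^2 - 1 + s * u^2 - e * u^4 = 0"
    using assms(3) by (simp add: chart_ham_def)
  have du: "fls_deriv X * u + X * fls_deriv u = 0"
    using arg_cong[OF Xu, of fls_deriv] by (simp add: add.commute)
  have dv: "fls_deriv Y * u^2 + Y * (2 * u * fls_deriv u) = fls_deriv v"
    by (simp flip: Yu add: power2_eq_square algebra_simps)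
  note D = assms(1,2)[unfolded chart_du_def chart_dv_def, simplified]
  show "fls_deriv X = 2 * Y"
    using Xu Yu ham du dv D by Groebner_Basis.algebra
  show "fls_deriv Y = 4 * X^3 - 2 * s * X"
    using Xu Yu ham du dv D by Groebner_Basis.algebra
  show "Y^2 = X^4 - s * X^2 + e"
    using Xu Yu ham du dv D by Groebner_Basis.algebra
qed

lemma chart_equations_6:
  fixes u v s e :: "complex fls"
  assumes "fls_deriv u = chart_du 6 s e u v" "fls_deriv v = chart_dv 6 s e u v"
    and "chart_ham 6 s e u v = 0" "u \<noteq> 0"
  defines "X \<equiv> chart_x 6 u v" and "Y \<equiv> chart_y 6 u v"
  shows "fls_deriv X = 2 * X * Y + 2 * s * Y" "fls_deriv Y = 3 * X^2 - Y^2 - 6 * s * X"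
    "X * (Y^2 - X^2) + s * (3 * X^2 + Y^2) = e"
proof -
  have Yu: "Y * u = 1" and Xu: "X * u = v"
    using \<open>u \<noteq> 0\<close> by (simp_all add: X_def Y_def chart_x_def chart_y_def)
  have ham: "v - v^3 + s * u * (3 * v^2 + 1) - e * u^3 = 0"
    using assms(3) by (simp add: chart_ham_def)
  have du: "fls_deriv Y * u + Y * fls_deriv u = 0"
    using arg_cong[OF Yu, of fls_deriv] by (simp add: add.commute)
  have dv: "fls_deriv X * u + X * fls_deriv u = fls_deriv v"
    by (simp flip: Xu add: add.commute)
  note D = assms(1,2)[unfolded chart_du_def chart_dv_def, simplified]
  \<comment> \<open>The left-hand side is u^2 F, obtained from H = u^3 F;
    \<open>fls_deriv X * u\<close> is 2 X + 2 s minus three times it.\<close>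
  have ham': "X - X^3 * u^2 + s * (3 * X^2 * u^2 + 1) - e * u^2 = 0"
  proof -
    have "u * (X - X^3 * u^2 + s * (3 * X^2 * u^2 + 1) - e * u^2) = 0"
      using ham unfolding Xu[symmetric] by Groebner_Basis.algebra
    then show ?thesis
      using \<open>u \<noteq> 0\<close> by simp
  qed
  have "fls_deriv X * u = 2 * X + 2 * s"
    using dv[unfolded D] ham' unfolding Xu[symmetric] by Groebner_Basis.algebra
  then show "fls_deriv X = 2 * X * Y + 2 * s * Y"
    using eq_mult_inverse[OF Yu] by (metis distrib_right)
  have X: "X = v * Y"
    by (rule eq_mult_inverse[OF Yu Xu])
  have "fls_deriv Y * u = - Y * fls_deriv u"
    using du by (simp add: eq_neg_iff_add_eq_0)
  then have "fls_deriv Y = - Y * (1 - 3 * v^2 + 6 * s * u * v) * Y"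
    unfolding D by (rule eq_mult_inverse[OF Yu])
  also have "\<dots> = 3 * X^2 - Y^2 - 6 * s * X * (Y * u)"
    unfolding X by Groebner_Basis.algebra
  finally show "fls_deriv Y = 3 * X^2 - Y^2 - 6 * s * X"
    by (simp add: Yu)
  have "X * (Y^2 - X^2 * (Y * u)^2) + s * (3 * X^2 * (Y * u)^2 + Y^2) - e * (Y * u)^2 =
      Y^2 * (X - X^3 * u^2 + s * (3 * X^2 * u^2 + 1) - e * u^2)"
    by Groebner_Basis.algebra
  then show "X * (Y^2 - X^2) + s * (3 * X^2 + Y^2) = e"
    unfolding ham' Yu by simp
qed


subsection \<open>Laurent expansions in the charts\<close>

text \<open>
  For \<open>p = 3\<close> the coordinate \<open>v\<close> vanishes to order 3; solving \<open>chart_ham 3 s e u v = 0\<close> for the linear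
  occurrence of \<open>v\<close> gives \<open>v = z\<^sup>3 * chart_W s e u v\<close>.
\<close>

definition chart_W :: "'a::field \<Rightarrow> 'a \<Rightarrow> 'a fps \<Rightarrow> 'a fps \<Rightarrow> 'a fps" where
  "chart_W s e u v =
     4 * fps_shift 1 u ^ 3 * inverse (1 + fps_const s * u * v + fps_const e * v^2)"

text \<open>The power series z^k x with k = \<open>pw_x p\<close>: the powers of z are cancelled
  after writing u = z R with R = \<open>fps_shift 1 u\<close> and, for p = 3, v = z^3 W. The series
  for y is formed in the same way.\<close>

definition chart_xcoeffs :: "nat \<Rightarrow> complex \<times> complex \<Rightarrow> complex fps \<Rightarrow> complex fps \<Rightarrow> complex fps" where
  "chart_xcoeffs p g u v =
     (if p = 3 then fps_shift 1 u * inverse (chart_W (fst g) (energy p g) u v)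
      else if p = 4 then inverse (fps_shift 1 u)
      else v * inverse (fps_shift 1 u))"

definition chart_ycoeffs :: "nat \<Rightarrow> complex \<times> complex \<Rightarrow> complex fps \<Rightarrow> complex fps \<Rightarrow> complex fps" where
  "chart_ycoeffs p g u v =
     (if p = 3 then inverse (chart_W (fst g) (energy p g) u v)
      else if p = 4 then v * inverse (fps_shift 1 u) ^ 2
      else inverse (fps_shift 1 u))"

text \<open>Constant terms of the two series above, computed from u'(0), from W(0) = -4 for p = 3,
  and from v(0)^2 = 1 for p = 4.\<close>

definition chart_lead :: "nat \<Rightarrow> 'a::field \<Rightarrow> 'a \<times> 'a" where
  "chart_lead p v = (if p = 3 then (1/4, - 1/4) else if p = 4 then (- v/2, v/4)
     else (v / (1 - 3 * v^2), 1 / (1 - 3 * v^2)))"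

lemma fps_to_fls_divide_X_power_nth:
  fixes f :: "'a::field fps"
  shows "(fps_to_fls f / fls_X ^ k) $$ n = (if n < - int k then 0 else f $ nat (n + int k))"
proof -
  have "fls_X ^ k * fls_shift (int k) (fps_to_fls f) = fps_to_fls f"
    by (simp add: fls_X_power_times_conv_shift)
  then have "fps_to_fls f / fls_X ^ k = fls_shift (int k) (fps_to_fls f)"
    by (metis fls_X_nonzero nonzero_mult_div_cancel_left power_eq_0_iff)
  then show ?thesis
    by simp
qed

text \<open>The constant term of \<open>fps_shift 1 u\<close> is u'(0), the u-component of the
  vector field at the point at infinity. It is nonzero by transversality, so u vanishes to order
  exactly one.\<close>

lemma chart_solution_shift:
  assumes "p \<in> {3, 4, 6}" "chart_solution p g u v"
  shows "v $ 0 \<in> chart_inits p" "u = fps_X * fps_shift 1 u"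
    "fps_shift 1 u $ 0 = (if p = 3 then - 1 else if p = 4 then - 2 * v $ 0 else 1 - 3 * (v $ 0)^2)"
    "fps_shift 1 u $ 0 \<noteq> 0"
proof -
  show v0: "v $ 0 \<in> chart_inits p"
    using assms(2) by (simp add: chart_solution_def)
  have u0: "u $ 0 = 0" and du: "fps_deriv u = chart_du p (fps_const (fst g)) (fps_const (energy p g)) u v"
    using assms(2) by (auto simp: chart_solution_def)
  show "u = fps_X * fps_shift 1 u"
    using u0 by (intro fps_ext) (simp add: fps_X_mult_nth)
  have "fps_shift 1 u $ 0 = fps_deriv u $ 0"
    by simp
  then show *: "fps_shift 1 u $ 0 =
      (if p = 3 then - 1 else if p = 4 then - 2 * v $ 0 else 1 - 3 * (v $ 0)^2)"
    unfolding du using assms(1) u0 v0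
    by (auto simp: chart_du_def fps_power_zeroth chart_inits_def)
  show "fps_shift 1 u $ 0 \<noteq> 0"
    unfolding * using v0 assms(1) by (auto simp: chart_inits_def)
qed

lemma chart_W:
  assumes "chart_solution 3 g u v"
  defines "W \<equiv> chart_W (fst g) (energy 3 g) u v"
  shows "v = fps_X ^ 3 * W" "W $ 0 = - 4"
proof -
  define D where "D = 1 + fps_const (fst g) * u * v + fps_const (energy 3 g) * v^2"
  have u0: "u $ 0 = 0" and v0: "v $ 0 = 0"
    using assms(1) chart_solution_shift(1)[of 3 g u v]
    by (auto simp: chart_solution_def chart_inits_def)
  have D0: "D $ 0 = 1"
    by (simp add: D_def u0 v0 fps_power_zeroth)
  have "v * D = 4 * u^3"
    using assms(1) unfolding chart_solution_def chart_ham_def D_def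
    by (simp add: power2_eq_square power3_eq_cube algebra_simps)
  then have "v * (D * inverse D) = 4 * (fps_X * fps_shift 1 u)^3 * inverse D"
    using chart_solution_shift(2)[of 3 g u v] assms(1) by (simp flip: mult.assoc)
  then have "v = 4 * (fps_X * fps_shift 1 u)^3 * inverse D"
    using D0 by (simp add: inverse_mult_eq_1')
  also have "\<dots> = fps_X ^ 3 * (4 * fps_shift 1 u ^ 3 * inverse D)"
    by (simp add: power_mult_distrib mult_ac)
  also have "4 * fps_shift 1 u ^ 3 * inverse D = W"
    by (simp add: W_def chart_W_def D_def)
  finally show "v = fps_X ^ 3 * W" .
  show "W $ 0 = - 4"
    using chart_solution_shift(3)[of 3 g u v] assms(1)
    by (simp add: W_def chart_W_def D_def[symmetric] D0 fps_power_zeroth)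
qed

lemma chart_expansion:
  assumes "p \<in> {3, 4, 6}" "chart_solution p g u v"
  shows "fps_to_fls u \<noteq> 0" "p = 3 \<Longrightarrow> fps_to_fls v \<noteq> 0"
    and "chart_x p (fps_to_fls u) (fps_to_fls v) = fps_to_fls (chart_xcoeffs p g u v) / fls_X ^ pw_x p"
    and "chart_y p (fps_to_fls u) (fps_to_fls v) = fps_to_fls (chart_ycoeffs p g u v) / fls_X ^ pw_y p"
    and "(chart_xcoeffs p g u v $ 0, chart_ycoeffs p g u v $ 0) = chart_lead p (v $ 0)"
proof -
  define R where "R = fps_shift 1 u"
  define r where "r = fps_to_fls R"
  note shift = chart_solution_shift[OF assms, folded R_def]
  have u: "fps_to_fls u = fls_X * r"
    by (subst shift(2)) (simp add: fls_times_fps_to_fls r_def)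
  have "r \<noteq> 0"
    using shift(4) by (auto simp: r_def)
  then show "fps_to_fls u \<noteq> 0"
    by (simp add: u)
  have r': "fps_to_fls (inverse R) = 1 / r"
  proof -
    have "fps_to_fls (R * inverse R) = 1"
      using shift(4) by (simp add: inverse_mult_eq_1')
    then show ?thesis
      using \<open>r \<noteq> 0\<close> by (simp add: fls_times_fps_to_fls r_def field_simps)
  qed
  define W where "W = chart_W (fst g) (energy p g) u v"
  define w where "w = fps_to_fls W"
  have W: "fps_to_fls v = fls_X ^ 3 * w" "W $ 0 = - 4" if "p = 3"
  proof -
    have "chart_solution 3 g u v" "W = chart_W (fst g) (energy 3 g) u v"
      using that assms(2) by (simp_all add: W_def)
    then have "v = fps_X ^ 3 * W" "W $ 0 = - 4"
      using chart_W by simp_all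
    then show "fps_to_fls v = fls_X ^ 3 * w" "W $ 0 = - 4"
      by (simp_all add: fls_times_fps_to_fls fps_to_fls_power w_def)
  qed
  have "w \<noteq> 0" if "p = 3"
    using W(2)[OF that] by (auto simp: w_def)
  then show "fps_to_fls v \<noteq> 0" if "p = 3"
    using that by (simp add: W)
  have w': "fps_to_fls (inverse W) = 1 / w" if "p = 3"
  proof -
    have "fps_to_fls (W * inverse W) = 1"
      using W(2)[OF that] by (subst inverse_mult_eq_1') simp_all
    then show ?thesis
      using \<open>p = 3 \<Longrightarrow> w \<noteq> 0\<close> that by (simp add: fls_times_fps_to_fls w_def field_simps)
  qed
  define z where "z = (fls_X :: complex fls)"
  have "z \<noteq> 0"
    by (simp add: z_def)
  note nonzero = \<open>r \<noteq> 0\<close> \<open>z \<noteq> 0\<close> \<open>p = 3 \<Longrightarrow> w \<noteq> 0\<close>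
  show "chart_x p (fps_to_fls u) (fps_to_fls v) = fps_to_fls (chart_xcoeffs p g u v) / fls_X ^ pw_x p"
    using assms(1) nonzero W(1)
    unfolding chart_x_def chart_xcoeffs_def u R_def[symmetric] W_def[symmetric] z_def[symmetric]
    by (auto simp: pw_x_def fls_times_fps_to_fls w' r' r_def[symmetric] field_simps
        power2_eq_square power3_eq_cube)
  show "chart_y p (fps_to_fls u) (fps_to_fls v) = fps_to_fls (chart_ycoeffs p g u v) / fls_X ^ pw_y p"
    using assms(1) nonzero W(1)
    unfolding chart_y_def chart_ycoeffs_def u R_def[symmetric] W_def[symmetric] z_def[symmetric]
    by (auto simp: pw_y_def fls_times_fps_to_fls fps_to_fls_power w' r' r_def[symmetric] field_simps
        power2_eq_square power3_eq_cube)
  show "(chart_xcoeffs p g u v $ 0, chart_ycoeffs p g u v $ 0) = chart_lead p (v $ 0)"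
    using assms(1) shift(1,3) W(2)
    unfolding chart_xcoeffs_def chart_ycoeffs_def R_def[symmetric] W_def[symmetric]
    by (auto simp: chart_lead_def chart_inits_def fps_power_zeroth power2_eq_square)
qed

lemma chart_polar_solution:
  assumes "p \<in> {3, 4, 6}" "chart_solution p g u v"
  shows "polar_solution p g (chart_x p (fps_to_fls u) (fps_to_fls v)) (chart_y p (fps_to_fls u) (fps_to_fls v))"
    (is "polar_solution p g ?X ?Y")
proof -
  note sol = assms(2)[unfolded chart_solution_fls_iff]
  note exp = chart_expansion[OF assms]
  have "?X $$ (- int (pw_x p)) = chart_xcoeffs p g u v $ 0"
    "?Y $$ (- int (pw_y p)) = chart_ycoeffs p g u v $ 0"
    unfolding exp(3,4) by (simp_all add: fps_to_fls_divide_X_power_nth)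
  \<comment> \<open>Only the pair is nonzero: for p = 6 and v(0) = 0 the first entry vanishes and x
    is regular.\<close>
  moreover have "chart_lead p (v $ 0) \<noteq> (0, 0)"
    using assms(1) chart_solution_shift(1)[OF assms] by (auto simp: chart_lead_def chart_inits_def)
  moreover have "- int (pw_x p) < 0" "- int (pw_y p) < 0"
    by (simp_all add: pw_x_def pw_y_def)
  ultimately have pole: "\<exists>n<0. ?X $$ n \<noteq> 0 \<or> ?Y $$ n \<noteq> 0"
    using exp(5) by (metis prod.inject)
  consider "p = 3" | "p = 4" | "p = 6"
    using assms(1) by blast
  then show ?thesis
  proof cases
    case 1
    then show ?thesis
      using sol pole exp(2) chart_equations_3[of "fps_to_fls u" "fls_const (fst g)" "fls_const (energy 3 g)" "fps_to_fls v"]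
      by (simp add: polar_solution_iff)
  next
    case 2
    then show ?thesis
      using sol pole exp(1) chart_equations_4[of "fps_to_fls u" "fls_const (fst g)" "fls_const (energy 4 g)" "fps_to_fls v"]
      by (simp add: polar_solution_iff)
  next
    case 3
    then show ?thesis
      using sol pole exp(1) chart_equations_6[of "fps_to_fls u" "fls_const (fst g)" "fls_const (energy 6 g)" "fps_to_fls v"]
      by (simp add: polar_solution_iff)
  qed
qed


subsection \<open>Leading coefficients\<close>

definition leads :: "nat \<Rightarrow> (complex \<times> complex) set" where
  "leads p = (if p = 3 then {(1/4, - 1/4)} else if p = 4 then {(- 1/2, 1/4), (1/2, - 1/4)}
     else {(0, 1), (1/2, - 1/2), (- 1/2, - 1/2)})"

text \<open>Read at fixed orders instead of the actual pole orders: entries may vanish, and the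
  value is (0, 0) where there is no pole. This makes it continuous over the covering.\<close>

definition laurent_lead :: "nat \<Rightarrow> complex fls \<Rightarrow> complex fls \<Rightarrow> complex \<times> complex" where
  "laurent_lead p X Y = (X $$ (- int (pw_x p)), Y $$ (- int (pw_y p)))"

lemma chart_lead_bij: "bij_betw (chart_lead p) (chart_inits p) (leads p)"
  by (auto simp: bij_betw_def inj_on_def chart_lead_def chart_inits_def leads_def)

lemma zero_notin_leads: "(0, 0) \<notin> leads p"
  by (auto simp: leads_def)

lemma polar_solution_leading:
  assumes "p \<in> {3, 4, 6}" "polar_solution p g X Y"
  shows "laurent_lead p X Y \<in> leads p"
    and "n < - int (pw_x p) \<Longrightarrow> X $$ n = 0" "n < - int (pw_y p) \<Longrightarrow> Y $$ n = 0"
proof -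
  obtain u v where uv: "chart_solution p g u v"
    and X: "X = chart_x p (fps_to_fls u) (fps_to_fls v)" and Y: "Y = chart_y p (fps_to_fls u) (fps_to_fls v)"
    using polar_solution_chart[OF assms] .
  note exp = chart_expansion[OF assms(1) uv]
  have "laurent_lead p X Y = chart_lead p (v $ 0)"
    unfolding laurent_lead_def X Y exp(3,4) by (simp add: fps_to_fls_divide_X_power_nth exp(5))
  then show "laurent_lead p X Y \<in> leads p"
    using chart_lead_bij chart_solution_shift(1)[OF assms(1) uv] by (metis bij_betwE)
  show "X $$ n = 0" if "n < - int (pw_x p)"
    using that unfolding X exp(3) by (simp add: fps_to_fls_divide_X_power_nth)
  show "Y $$ n = 0" if "n < - int (pw_y p)"
    using that unfolding Y exp(4) by (simp add: fps_to_fls_divide_X_power_nth)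
qed

lemma causal_chart:
  "causal (chart_du p s e)" "causal (chart_dv p s e)"
  unfolding causal_def chart_du_def chart_dv_def
  by (auto intro!: agree_upto_intros)

text \<open>Injectivity of \<open>chart_lead\<close> recovers v(0) from the leading coefficients,
  and v(0) is the only free datum of the initial value problem.\<close>

lemma polar_solution_unique:
  assumes p: "p \<in> {3, 4, 6}" and "polar_solution p g X Y" "polar_solution p g X' Y'"
    and "laurent_lead p X Y = laurent_lead p X' Y'"
  shows "X = X' \<and> Y = Y'"
proof -
  obtain u v where uv: "chart_solution p g u v"
    and X: "X = chart_x p (fps_to_fls u) (fps_to_fls v)" and Y: "Y = chart_y p (fps_to_fls u) (fps_to_fls v)"
    using polar_solution_chart[OF p assms(2)] .
  obtain u' v' where uv': "chart_solution p g u' v'"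
    and X': "X' = chart_x p (fps_to_fls u') (fps_to_fls v')"
    and Y': "Y' = chart_y p (fps_to_fls u') (fps_to_fls v')"
    using polar_solution_chart[OF p assms(3)] .
  note exp = chart_expansion[OF p uv] and exp' = chart_expansion[OF p uv']
  have "laurent_lead p X Y = chart_lead p (v $ 0)"
    unfolding laurent_lead_def X Y exp(3,4) by (simp add: fps_to_fls_divide_X_power_nth exp(5))
  moreover have "laurent_lead p X' Y' = chart_lead p (v' $ 0)"
    unfolding laurent_lead_def X' Y' exp'(3,4) by (simp add: fps_to_fls_divide_X_power_nth exp'(5))
  ultimately have "v $ 0 = v' $ 0"
    using assms(4) chart_lead_bij[of p] chart_solution_shift(1)[OF p uv] chart_solution_shift(1)[OF p uv']
    by (metis bij_betw_imp_inj_on inj_onD)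
  then have "u = u' \<and> v = v'"
    using uv uv' by (intro fps_ivp_unique[OF causal_chart[of p "fps_const (fst g)" "fps_const (energy p g)"]])
      (simp_all add: chart_solution_def)
  then show ?thesis
    by (simp add: X X' Y Y')
qed


subsection \<open>Existence of the weighted homogeneous solutions\<close>

text \<open>Conservation of energy: the right-hand sides are \<plusminus> (- H_v, H_u), so the chain
  rule gives zero. Hence H = 0 needs checking only at the initial point.\<close>

lemma chart_ham_deriv:
  fixes u v s e :: "'a::field fps"
  assumes "p \<in> {3, 4, 6}"
    and "fps_deriv u = chart_du p s e u v" "fps_deriv v = chart_dv p s e u v"
    and "fps_deriv s = 0" "fps_deriv e = 0"
  shows "fps_deriv (chart_ham p s e u v) = 0"
proof -
  consider "p = 3" | "p = 4" | "p = 6"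
    using assms(1) by blast
  then show ?thesis
    by cases (simp_all add: chart_ham_def assms(2-5) power2_eq_square power3_eq_cube power4_eq_xxxx
        chart_du_def chart_dv_def algebra_simps)
qed

lemma chart_solution_exists:
  assumes p: "p \<in> {3, 4, 6}" and "v0 \<in> chart_inits p"
  shows "\<exists>u v. chart_solution p g u v \<and> v $ 0 = v0"
proof -
  obtain u v where uv: "fps_deriv u = chart_du p (fps_const (fst g)) (fps_const (energy p g)) u v"
    "fps_deriv v = chart_dv p (fps_const (fst g)) (fps_const (energy p g)) u v" "u $ 0 = 0" "v $ 0 = v0"
    using fps_ivp_exists[OF causal_chart] by blast
  let ?H = "chart_ham p (fps_const (fst g)) (fps_const (energy p g)) u v"
  have "?H $ 0 = chart_ham p (fst g) (energy p g) 0 v0"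
    using uv(3,4) by (simp add: chart_ham_def fps_power_zeroth)
  then have "?H $ 0 = 0"
    using assms(2) chart_ham_inits by metis
  moreover have "fps_deriv ?H = 0"
    using chart_ham_deriv[OF p uv(1,2)] by simp
  ultimately have "?H = 0"
    by (simp add: fps_deriv_eq_0_iff)
  then show ?thesis
    using uv assms(2) unfolding chart_solution_def by blast
qed

lemma weighted_upto_energy:
  assumes "p \<in> {3, 4, 6}"
  shows "weighted_upto p n 1 (\<lambda>g. fps_const (energy p g))"
proof (rule weighted_upto_fps_const)
  have "rational_weighted_poly p 1 (\<lambda>g. of_rat 1 * fst g ^ 0 * snd g ^ 1)"
    by (rule rational_weighted_poly_monomial) (simp add: wt_gl_def)
  moreover have "rational_weighted_poly p 1 (\<lambda>g. of_rat (1/8) * fst g ^ 2 * snd g ^ 0)" if "p = 4"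
    by (rule rational_weighted_poly_monomial) (simp add: wt_gs_def that)
  moreover have "rational_weighted_poly p 1 (\<lambda>g. of_rat 2 * fst g ^ 3 * snd g ^ 0)" if "p = 6"
    by (rule rational_weighted_poly_monomial) (simp add: wt_gs_def that)
  ultimately show "rational_weighted_poly p 1 (energy p)"
    using assms rational_weighted_poly_add unfolding energy_def
    by (auto simp: of_rat_divide)
qed

text \<open>The weight of v as 1/y, y/x^2, x/y. The weight of u is \<open>wt_z p\<close> in all
  three cases, in accordance with its simple zero at z = 0.\<close>

definition wt_chart_v :: "nat \<Rightarrow> rat" where
  "wt_chart_v p = (if p = 3 then - 1/2 else 0)"

lemma weighted_upto_chart:
  assumes p: "p \<in> {3, 4, 6}" and u: "weighted_upto p n (wt_z p) U" and v: "weighted_upto p n (wt_chart_v p) V"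
  shows "weighted_upto p n (wt_z p - wt_z p)
           (\<lambda>g. chart_du p (fps_const (fst g)) (fps_const (energy p g)) (U g) (V g))"
    and "weighted_upto p n (wt_chart_v p - wt_z p)
           (\<lambda>g. chart_dv p (fps_const (fst g)) (fps_const (energy p g)) (U g) (V g))"
proof -
  note monomial = weighted_upto_mult weighted_upto_power weighted_upto_numeral weighted_upto_one
    weighted_upto_gs weighted_upto_energy[OF p] u v weighted_upto_uminus[OF weighted_upto_numeral]
  note weights = wt_z_def wt_chart_v_def wt_gs_def
  consider (A2) "p = 3" | (B2) "p = 4" | (G2) "p = 6"
    using p by blast
  then show "weighted_upto p n (wt_z p - wt_z p)
      (\<lambda>g. chart_du p (fps_const (fst g)) (fps_const (energy p g)) (U g) (V g))"
  proof cases
    case A2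
    have eq: "chart_du p s e x y = - 1 - 2 * s * x * y - 3 * e * y^2" for s e x y :: "complex fps"
      by (simp add: chart_du_def A2)
    show ?thesis
      unfolding eq
      by (intro weighted_upto_add weighted_upto_diff weighted_upto_uminus;
          (rule weighted_upto_weight, (rule monomial)+, simp add: weights A2))
  next
    case B2
    have eq: "chart_du p s e x y = - 2 * y" for s e x y :: "complex fps"
      by (simp add: chart_du_def B2)
    show ?thesis
      unfolding eq
      by (rule weighted_upto_weight, (rule monomial)+, simp add: weights B2)
  next
    case G2
    have eq: "chart_du p s e x y = 1 - 3 * y^2 + 6 * s * x * y" for s e x y :: "complex fps"
      by (simp add: chart_du_def G2)
    show ?thesis
      unfolding eq
      by (intro weighted_upto_add weighted_upto_diff weighted_upto_uminus;
          (rule weighted_upto_weight, (rule monomial)+, simp add: weights G2))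
  qed
  consider (A2) "p = 3" | (B2) "p = 4" | (G2) "p = 6"
    using p by blast
  then show "weighted_upto p n (wt_chart_v p - wt_z p)
      (\<lambda>g. chart_dv p (fps_const (fst g)) (fps_const (energy p g)) (U g) (V g))"
  proof cases
    case A2
    have eq: "chart_dv p s e x y = s * y^2 - 12 * x^2" for s e x y :: "complex fps"
      by (simp add: chart_dv_def A2)
    show ?thesis
      unfolding eq
      by (intro weighted_upto_add weighted_upto_diff weighted_upto_uminus;
          (rule weighted_upto_weight, (rule monomial)+, simp add: weights A2))
  next
    case B2
    have eq: "chart_dv p s e x y = 2 * s * x - 4 * e * x^3" for s e x y :: "complex fps"
      by (simp add: chart_dv_def B2)
    show ?thesis
      unfolding eq
      by (intro weighted_upto_add weighted_upto_diff weighted_upto_uminus;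
          (rule weighted_upto_weight, (rule monomial)+, simp add: weights B2))
  next
    case G2
    have eq: "chart_dv p s e x y = 3 * e * x^2 - s - 3 * s * y^2" for s e x y :: "complex fps"
      by (simp add: chart_dv_def G2)
    show ?thesis
      unfolding eq
      by (intro weighted_upto_add weighted_upto_diff weighted_upto_uminus;
          (rule weighted_upto_weight, (rule monomial)+, simp add: weights G2))
  qed
qed

lemma weighted_upto_coeffs:
  assumes p: "p \<in> {3, 4, 6}"
    and sol: "\<And>g. chart_solution p g (U g) (V g)" and V0: "\<And>g. V g $ 0 = of_rat q"
    and u: "\<And>n. weighted_upto p n (wt_z p) U" and v: "\<And>n. weighted_upto p n (wt_chart_v p) V"
  shows "weighted_upto p n 0 (\<lambda>g. chart_xcoeffs p g (U g) (V g))"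
    and "weighted_upto p n 0 (\<lambda>g. chart_ycoeffs p g (U g) (V g))"
proof -
  note shift = chart_solution_shift[OF p sol]
  have R: "weighted_upto p n 0 (\<lambda>g. fps_shift 1 (U g))" for n
    using weighted_upto_shift[OF u, of n 1] by simp
  \<comment> \<open>The number u'(0) again, now as a rational constant, as
    \<open>weighted_upto_inverse\<close> demands. Since it is the same for all g, the arbitrary
    parameter \<open>undefined\<close> serves to show that it is nonzero.\<close>
  define r where "r = (if p = 3 then - 1 else if p = 4 then - 2 * q else 1 - 3 * q^2)"
  have r: "fps_shift 1 (U g) $ 0 = of_rat r" for g
    using shift(3)[of g] by (simp add: r_def V0 of_rat_mult of_rat_diff of_rat_power of_rat_minus)
  have "r \<noteq> 0"
    using shift(4)[of undefined] unfolding r by simp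
  then have R': "weighted_upto p n 0 (\<lambda>g. inverse (fps_shift 1 (U g)))" for n
    using weighted_upto_inverse[OF R r] by simp
  have W': "weighted_upto p n 0 (\<lambda>g. inverse (chart_W (fst g) (energy p g) (U g) (V g)))"
    if "p = 3" for n
  proof -
    have V00: "V g $ 0 = 0" for g
      using shift(1)[of g] that by (simp add: chart_inits_def)
    have "weighted_upto p n 0 (\<lambda>g. fps_const (fst g) * U g * V g)" for n
      by (rule weighted_upto_weight, (rule weighted_upto_mult weighted_upto_gs u v)+)
        (simp add: that wt_gs_def wt_z_def wt_chart_v_def)
    moreover have "weighted_upto p n 0 (\<lambda>g. fps_const (energy p g) * V g ^ 2)" for n
      by (rule weighted_upto_weight, (rule weighted_upto_mult weighted_upto_energy[OF p] weighted_upto_power v)+)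
        (simp add: that wt_chart_v_def)
    ultimately have D: "weighted_upto p n 0
        (\<lambda>g. 1 + fps_const (fst g) * U g * V g + fps_const (energy p g) * V g ^ 2)" for n
      by (intro weighted_upto_add weighted_upto_one)
    have "weighted_upto p n 0 (\<lambda>g. inverse (1 + fps_const (fst g) * U g * V g + fps_const (energy p g) * V g ^ 2))" for n
      by (rule weighted_upto_inverse[OF D, of 1]) (simp_all add: V00 fps_power_zeroth)
    then have W: "weighted_upto p n 0 (\<lambda>g. chart_W (fst g) (energy p g) (U g) (V g))" for n
      unfolding chart_W_def
      using weighted_upto_mult[OF weighted_upto_mult[OF weighted_upto_numeral weighted_upto_power[OF R]]]
      by fastforce
    show ?thesis
      by (rule weighted_upto_inverse[OF W, of "-4"]) (use chart_W(2) sol that in \<open>auto simp: of_rat_minus\<close>)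
  qed
  have v0: "weighted_upto p n 0 V" if "p \<noteq> 3" for n
    using v that by (simp add: wt_chart_v_def)
  show "weighted_upto p n 0 (\<lambda>g. chart_xcoeffs p g (U g) (V g))"
    using weighted_upto_mult[OF R W'] weighted_upto_mult[OF v0 R'] R'
    by (cases "p = 3"; cases "p = 4") (simp_all add: chart_xcoeffs_def)
  show "weighted_upto p n 0 (\<lambda>g. chart_ycoeffs p g (U g) (V g))"
    using W' weighted_upto_mult[OF v0 weighted_upto_power[OF R', of _ 2]] R'
    by (cases "p = 3"; cases "p = 4") (simp_all add: chart_ycoeffs_def)
qed

text \<open>One rational initial value is used for all g in C^2 simultaneously, so the coefficients
  become functions on the whole parameter plane and can be recognized as polynomials.\<close>

lemma polar_solution_exists:
  assumes p: "p \<in> {3, 4, 6}" and a: "a \<in> leads p"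
  shows "\<exists>X Y. \<forall>g. polar_solution p g (X g) (Y g) \<and> laurent_lead p (X g) (Y g) = a \<and>
    (\<forall>n. rational_weighted_poly p (wt_x p - of_int n * wt_z p) (\<lambda>g. X g $$ n) \<and>
         rational_weighted_poly p (wt_y p - of_int n * wt_z p) (\<lambda>g. Y g $$ n))"
proof -
  have "of_rat ` chart_inits p = (chart_inits p :: complex set)"
    by (auto simp: chart_inits_def of_rat_minus)
  then obtain q where q: "q \<in> chart_inits p" "of_rat q \<in> (chart_inits p :: complex set)"
    "a = chart_lead p (of_rat q)"
    using a bij_betw_imp_surj_on[OF chart_lead_bij[of p]] by (metis (no_types, lifting) imageE image_eqI)
  have "\<forall>g. \<exists>u v. chart_solution p g u v \<and> v $ 0 = of_rat q"
    using chart_solution_exists[OF p q(2)] by blast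
  then obtain U V where sol: "\<And>g. chart_solution p g (U g) (V g)" and V0: "\<And>g. V g $ 0 = of_rat q"
    by metis
  have "weighted_upto p n (wt_z p) U \<and> weighted_upto p n (wt_chart_v p) V" for n
  proof (rule weighted_ivp[where \<Phi> = "\<lambda>g. chart_du p (fps_const (fst g)) (fps_const (energy p g))"
        and \<Psi> = "\<lambda>g. chart_dv p (fps_const (fst g)) (fps_const (energy p g))"])
    show "fps_deriv (U g) = chart_du p (fps_const (fst g)) (fps_const (energy p g)) (U g) (V g)"
      "fps_deriv (V g) = chart_dv p (fps_const (fst g)) (fps_const (energy p g)) (U g) (V g)" for g
      using sol by (simp_all add: chart_solution_def)
    show "rational_weighted_poly p (wt_z p) (\<lambda>g. U g $ 0)"
      using sol by (simp add: chart_solution_def rational_weighted_poly_zero)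
    show "rational_weighted_poly p (wt_chart_v p) (\<lambda>g. V g $ 0)"
      using q(1) p by (auto simp: V0 chart_inits_def wt_chart_v_def rational_weighted_poly_zero
          rational_weighted_poly_const)
  qed (fact weighted_upto_chart[OF p])+
  then have weighted: "weighted_upto p n 0 (\<lambda>g. chart_xcoeffs p g (U g) (V g))"
    "weighted_upto p n 0 (\<lambda>g. chart_ycoeffs p g (U g) (V g))" for n
    using weighted_upto_coeffs[OF p sol V0] by blast+
  \<comment> \<open>Division by z^k turns weight 0 into \<open>- wt_z p * of_nat k\<close>, which is
    the weight of x or y for k = \<open>pw_x p\<close> or k = \<open>pw_y p\<close>.\<close>
  have laurent: "rational_weighted_poly p (- wt_z p * of_nat k - of_int n * wt_z p)
      (\<lambda>g. (fps_to_fls (A g) / fls_X ^ k) $$ n)" if "\<And>n. weighted_upto p n 0 A" for A k n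
  proof (cases "n < - int k")
    case False
    define m where "m = nat (n + int k)"
    have "rational_weighted_poly p (0 - of_nat m * wt_z p) (\<lambda>g. A g $ m)"
      using that[of m] by (auto simp: weighted_upto_def)
    moreover have "0 - of_nat m * wt_z p = - wt_z p * of_nat k - of_int n * wt_z p"
      using False by (simp add: m_def algebra_simps)
    ultimately show ?thesis
      using False by (simp add: fps_to_fls_divide_X_power_nth m_def)
  qed (simp add: fps_to_fls_divide_X_power_nth rational_weighted_poly_zero)
  define X where "X g = chart_x p (fps_to_fls (U g)) (fps_to_fls (V g))" for g
  define Y where "Y g = chart_y p (fps_to_fls (U g)) (fps_to_fls (V g))" for g
  have eq: "X = (\<lambda>g. fps_to_fls (chart_xcoeffs p g (U g) (V g)) / fls_X ^ pw_x p)"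
    "Y = (\<lambda>g. fps_to_fls (chart_ycoeffs p g (U g) (V g)) / fls_X ^ pw_y p)"
    using chart_expansion[OF p sol] by (auto simp: X_def Y_def)
  have "laurent_lead p (X g) (Y g) = a" for g
    unfolding laurent_lead_def eq q(3) using chart_expansion(5)[OF p sol[of g]]
    by (simp add: fps_to_fls_divide_X_power_nth V0)
  moreover have "polar_solution p g (X g) (Y g)" for g
    unfolding X_def Y_def by (rule chart_polar_solution[OF p sol])
  moreover have "rational_weighted_poly p (wt_x p - of_int n * wt_z p) (\<lambda>g. X g $$ n)"
    "rational_weighted_poly p (wt_y p - of_int n * wt_z p) (\<lambda>g. Y g $$ n)" for n
    unfolding eq pw_weights by (intro laurent weighted)+
  ultimately show ?thesis
    by blast
qed


subsection \<open>The cyclic symmetry and the points at infinity\<close>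

lemma fls_half: "(f :: complex fls) / 2 = fls_const (1 / 2) * f"
proof -
  have "fls_const (1 / 2) = (1 / 2 :: complex fls)"
    by (simp flip: fls_const_divide_const)
  then show ?thesis
    by simp
qed

lemma sigma_leads:
  assumes "p \<in> {3, 4, 6}" "a \<in> leads p"
  shows "sigma p a \<in> leads p" "leads p = {(sigma p ^^ k) a | k. k < p div 2}"
proof -
  show "sigma p a \<in> leads p"
    using assms by (auto simp: leads_def sigma_def)
  have iterates: "{(f ^^ k) a | k. k < n} = (\<lambda>k. (f ^^ k) a) ` {..<n}" for f :: "complex \<times> complex \<Rightarrow> _" and n
    by auto
  have orbit: "{(f ^^ k) a | k. k < Suc 0} = {a}" "{(f ^^ k) a | k. k < Suc (Suc 0)} = {a, f a}"
    "{(f ^^ k) a | k. k < Suc (Suc (Suc 0))} = {a, f a, f (f a)}" for f :: "complex \<times> complex \<Rightarrow> _"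
    unfolding iterates by (auto simp: lessThan_Suc)
  consider (A2) "p = 3" | (B2) "p = 4" | (G2) "p = 6"
    using assms(1) by blast
  then show "leads p = {(sigma p ^^ k) a | k. k < p div 2}"
  proof cases
    case A2
    then have N: "p div 2 = Suc 0"
      by simp
    show ?thesis
      unfolding N orbit using assms(2) A2 by (simp add: leads_def)
  next
    case B2
    then have N: "p div 2 = Suc (Suc 0)"
      by simp
    have "a = (- 1/2, 1/4) \<or> a = (1/2, - 1/4)"
      using assms(2) B2 by (simp add: leads_def)
    then show ?thesis
      unfolding N orbit using B2 by (elim disjE) (simp_all add: leads_def sigma_def insert_commute)
  next
    case G2
    then have N: "p div 2 = Suc (Suc (Suc 0))"
      by simp
    have "a = (0, 1) \<or> a = (1/2, - 1/2) \<or> a = (- 1/2, - 1/2)"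
      using assms(2) G2 by (simp add: leads_def)
    then show ?thesis
      unfolding N orbit using G2 by (elim disjE) (simp_all add: leads_def sigma_def insert_commute)
  qed
qed

text \<open>x and y are mixed only for p = 6, where both are read at the same order -1.\<close>

lemma laurent_lead_sigma:
  assumes "p \<in> {3, 4, 6}"
  shows "laurent_lead p (fst (sigma p (X, Y))) (snd (sigma p (X, Y))) = sigma p (laurent_lead p X Y)"
  using assms by (auto simp: laurent_lead_def sigma_def pw_x_def pw_y_def fls_half)

text \<open>\<open>sigma p\<close> is linear of determinant 1 and preserves F, so it is a symplectic
  symmetry and maps solutions to solutions. For p = 6 this is verified equation by equation.\<close>

lemma polar_solution_sigma:
  assumes p: "p \<in> {3, 4, 6}" and sol: "polar_solution p g X Y"
  shows "polar_solution p g (fst (sigma p (X, Y))) (snd (sigma p (X, Y)))"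
    (is "polar_solution p g ?X ?Y")
proof -
  have "laurent_lead p ?X ?Y \<noteq> (0, 0)"
    using laurent_lead_sigma[OF p] polar_solution_leading(1)[OF p sol] sigma_leads(1)[OF p]
      zero_notin_leads by metis
  moreover have "- int (pw_x p) < 0" "- int (pw_y p) < 0"
    by (simp_all add: pw_x_def pw_y_def)
  ultimately have pole: "\<exists>n<0. ?X $$ n \<noteq> 0 \<or> ?Y $$ n \<noteq> 0"
    unfolding laurent_lead_def by (metis prod.inject)
  consider (A2) "p = 3" | (B2) "p = 4" | (G2) "p = 6"
    using p by blast
  then show ?thesis
  proof cases
    case A2
    then show ?thesis
      using sol by (simp add: sigma_def)
  next
    case B2
    then show ?thesis
      using sol pole by (auto simp: polar_solution_iff sigma_def)
  next
    case G2
    define s where "s = fls_const (fst g)"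
    define e where "e = fls_const (energy 6 g)"
    \<comment> \<open>The symbol \<open>h\<close> stands for 1/2. Inserting powers of
      \<open>2 * h\<close> where the degrees in \<open>h\<close> differ turns the claims into
      polynomial identities.\<close>
    define h where "h = fls_const (1 / 2 :: complex)"
    have h: "2 * h = 1" "fls_deriv h = 0"
      by (simp add: h_def flip: fls_const_divide_const) (simp add: h_def)
    have X': "fls_deriv X = 2 * X * Y + 2 * s * Y" and Y': "fls_deriv Y = 3 * X^2 - Y^2 - 6 * s * X"
      and F: "X * (Y^2 - X^2) + s * (3 * X^2 + Y^2) = e"
      using sol G2 by (auto simp: polar_solution_iff s_def e_def)
    have XY: "?X = h * (Y - X)" "?Y = h * (- 3 * X - Y)"
      by (simp_all add: sigma_def G2 fls_half h_def)
    have "fls_deriv (h * (Y - X)) =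
        (2 * h) * h * (3 * X^2 - Y^2 - 2 * X * Y) - 2 * s * (h * (3 * X + Y))"
      unfolding h(1) by (simp add: X' Y' h(2) algebra_simps)
    also have "\<dots> = 2 * (h * (Y - X)) * (h * (- 3 * X - Y)) + 2 * s * (h * (- 3 * X - Y))"
      by Groebner_Basis.algebra
    finally have dX: "fls_deriv (h * (Y - X)) =
        2 * (h * (Y - X)) * (h * (- 3 * X - Y)) + 2 * s * (h * (- 3 * X - Y))" .
    have "fls_deriv (h * (- 3 * X - Y)) =
        (2 * h) * h * (Y^2 - 6 * X * Y - 3 * X^2) - 6 * s * (h * (Y - X))"
      unfolding h(1) by (simp add: X' Y' h(2) algebra_simps)
    also have "\<dots> = 3 * (h * (Y - X))^2 - (h * (- 3 * X - Y))^2 - 6 * s * (h * (Y - X))"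
      by Groebner_Basis.algebra
    finally have dY: "fls_deriv (h * (- 3 * X - Y)) =
        3 * (h * (Y - X))^2 - (h * (- 3 * X - Y))^2 - 6 * s * (h * (Y - X))" .
    have "h * (Y - X) * ((h * (- 3 * X - Y))^2 - (h * (Y - X))^2) +
        s * (3 * (h * (Y - X))^2 + (h * (- 3 * X - Y))^2) =
        (2 * h)^3 * (X * (Y^2 - X^2)) + (2 * h)^2 * (s * (3 * X^2 + Y^2))"
      by Groebner_Basis.algebra
    then have ham: "h * (Y - X) * ((h * (- 3 * X - Y))^2 - (h * (Y - X))^2) +
        s * (3 * (h * (Y - X))^2 + (h * (- 3 * X - Y))^2) = e"
      by (simp only: h(1) F) (simp add: F)
    show ?thesis
      using pole dX dY ham unfolding G2 polar_solution_iff XY[unfolded G2] s_def[symmetric] e_def[symmetric]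
      by blast
  qed
qed

section \<open>Points at infinity as limits of the solutions\<close>

definition lead_point :: "nat \<Rightarrow> complex \<times> complex \<Rightarrow> (complex \<times> complex \<times> complex) set" where
  "lead_point p a = wpoint p (fst a, snd a, 0)"

lemma sigma_lead_point: "sigma_wpoint p (lead_point p a) = lead_point p (sigma p a)"
  by (simp add: lead_point_def sigma_wpoint_wpoint)

text \<open>The scaling factor l = z is admissible: it removes the poles of x and y, the constant
  terms become the leading coefficients, which are not both zero, and the third entry is z, with
  constant term 0.\<close>

lemma laurent_limit_lead_point:
  assumes p: "p \<in> {3, 4, 6}" and sol: "polar_solution p g X Y"
  shows "laurent_limit p X Y (lead_point p (laurent_lead p X Y))"
proof -
  note lead = polar_solution_leading[OF p sol]
  have shift: "fls_subdegree (fls_X ^ k * f) \<ge> 0 \<and> (fls_X ^ k * f) $$ 0 = f $$ (- int k)"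
    if "\<And>n. n < - int k \<Longrightarrow> f $$ n = 0" for k and f :: "complex fls"
  proof
    show "(fls_X ^ k * f) $$ 0 = f $$ (- int k)"
      by (simp add: fls_X_power_times_conv_shift)
    have "fls_shift (- int k) f $$ n = 0" if "n < 0" for n
      using that \<open>\<And>n. n < - int k \<Longrightarrow> f $$ n = 0\<close> by simp
    then show "fls_subdegree (fls_X ^ k * f) \<ge> 0"
      unfolding fls_X_power_times_conv_shift
      by (cases "fls_shift (- int k) f = 0") (auto intro: fls_subdegree_geI)
  qed
  show ?thesis
    unfolding laurent_limit_def
  proof (intro exI conjI)
    show "wscale p fls_X (X, Y, 1) = (fls_X ^ pw_x p * X, fls_X ^ pw_y p * Y, fls_X)"
      by (simp add: wscale_def)
    show "((fls_X ^ pw_x p * X) $$ 0, (fls_X ^ pw_y p * Y) $$ 0, fls_X $$ 0) \<noteq> (0 :: complex \<times> complex \<times> complex)"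
      using lead(1) zero_notin_leads[of p] shift lead(2,3)
      by (auto simp: laurent_lead_def zero_prod_def)
    show "lead_point p (laurent_lead p X Y) =
        wpoint p ((fls_X ^ pw_x p * X) $$ 0, (fls_X ^ pw_y p * Y) $$ 0, fls_X $$ 0)"
      using shift lead(2,3) by (simp add: lead_point_def laurent_lead_def)
  qed (use shift lead(2,3) in auto)
qed

lemma lead_point_bij:
  assumes "p \<in> {3, 4, 6}"
  shows "bij_betw (lead_point p) (leads p) (points_at_infinity p g)"
proof -
  have mem_iff: "u \<in> wpoint p v \<longleftrightarrow> (\<exists>l. l \<noteq> 0 \<and> u = wscale p l v)" for u v
    by (auto simp: wpoint_def)
  have inj: "inj_on (lead_point p) (leads p)"
  proof (rule inj_onI)
    fix a b assume ab: "a \<in> leads p" "b \<in> leads p" "lead_point p a = lead_point p b"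
    have "(fst a, snd a, 0) \<in> lead_point p a"
      unfolding lead_point_def mem_iff by (rule exI[of _ 1]) simp
    then obtain l where "l \<noteq> 0" "(fst a, snd a, 0) = wscale p l (fst b, snd b, 0)"
      unfolding ab(3) unfolding lead_point_def mem_iff by blast
    \<comment> \<open>Separates the two points for p = 4: the first coordinates force l = -1, the
      second ones would need l^2 = -1.\<close>
    moreover have "l^2 = 1" if "- l = 1"
      using that by (metis power2_minus one_power2)
    ultimately show "a = b"
      using assms ab(1,2)
      by (auto simp: leads_def wscale_def pw_x_def pw_y_def)
  qed
  have "lead_point p a \<in> points_at_infinity p g" if "a \<in> leads p" for a
  proof -
    have "(fst a, snd a) \<noteq> 0 \<and> F_hom p (fst a, snd a, 0) g = 0"
      using that assms by (cases g) (auto simp: leads_def F_hom_def zero_prod_def power_divide)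
    then show ?thesis
      unfolding lead_point_def points_at_infinity_def by blast
  qed
  moreover have "P \<in> lead_point p ` leads p" if P: "P \<in> points_at_infinity p g" for P
  proof -
    obtain x y where xy: "(x, y) \<noteq> 0" "F_hom p (x, y, 0) g = 0" "P = wpoint p (x, y, 0)"
      using P unfolding points_at_infinity_def by blast
    have "\<exists>a\<in>leads p. \<exists>l. l \<noteq> 0 \<and> (x, y, 0) = wscale p l (fst a, snd a, 0)"
    proof -
      consider (A2) "p = 3" | (B2) "p = 4" | (G2) "p = 6"
        using assms by blast
      then show ?thesis
      proof cases
        case A2
        have eq: "y^2 = 4 * x^3"
          using xy(2) by (cases g) (simp add: F_hom_def A2)
        with xy(1) have "x \<noteq> 0"
          by (auto simp: zero_prod_def)
        with eq have "y \<noteq> 0"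
          by auto
        \<comment> \<open>The conditions l^2 / 4 = x and - l^3 / 4 = y leave only l = - y / x, as
          division of the second by the first shows.\<close>
        have "x = (- y / x)^2 * (1/4)"
          using eq \<open>x \<noteq> 0\<close> by (simp add: power_divide power2_eq_square power3_eq_cube)
        moreover have "y = (- y / x)^3 * (- 1/4)"
        proof -
          have "y^3 = y * (4 * x^3)"
            using eq by (simp add: power2_eq_square power3_eq_cube)
          then show ?thesis
            using \<open>x \<noteq> 0\<close> by (simp add: power_divide)
        qed
        ultimately show ?thesis
          using \<open>x \<noteq> 0\<close> \<open>y \<noteq> 0\<close> A2
          by (intro bexI[of _ "(1/4, - 1/4)"] exI[of _ "- y / x"])
            (simp_all add: wscale_def pw_x_def pw_y_def leads_def)
      next
        case B2
        have "y^2 = (x^2)^2"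
          using xy(2) by (cases g) (simp add: F_hom_def B2)
        then have y: "y = x^2 \<or> y = - (x^2)"
          using power2_eq_iff by blast
        then have "x \<noteq> 0"
          using xy(1) by (auto simp: zero_prod_def)
        from y show ?thesis
        proof
          assume "y = x^2"
          then show ?thesis
            using \<open>x \<noteq> 0\<close> B2 by (intro bexI[of _ "(- 1/2, 1/4)"] exI[of _ "- 2 * x"])
              (simp_all add: wscale_def pw_x_def pw_y_def leads_def power_mult_distrib)
        next
          assume "y = - (x^2)"
          then show ?thesis
            using \<open>x \<noteq> 0\<close> B2 by (intro bexI[of _ "(1/2, - 1/4)"] exI[of _ "2 * x"])
              (simp_all add: wscale_def pw_x_def pw_y_def leads_def power_mult_distrib)
        qed
      next
        case G2
        have "x * (y^2 - x^2) = 0"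
          using xy(2) by (cases g) (simp add: F_hom_def G2)
        then consider "x = 0" | "y = x" "x \<noteq> 0" | "y = - x" "x \<noteq> 0"
          using power2_eq_iff[of y x] by auto
        then show ?thesis
        proof cases
          case 1
          then have "y \<noteq> 0"
            using xy(1) by (auto simp: zero_prod_def)
          then show ?thesis
            using 1 G2 by (intro bexI[of _ "(0, 1)"] exI[of _ y])
              (simp_all add: wscale_def pw_x_def pw_y_def leads_def)
        next
          case 2
          then show ?thesis
            using G2 by (intro bexI[of _ "(- 1/2, - 1/2)"] exI[of _ "- 2 * x"])
              (simp_all add: wscale_def pw_x_def pw_y_def leads_def)
        next
          case 3
          then show ?thesis
            using G2 by (intro bexI[of _ "(1/2, - 1/2)"] exI[of _ "2 * x"])
              (simp_all add: wscale_def pw_x_def pw_y_def leads_def)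
        qed
      qed
    qed
    then show ?thesis
      unfolding xy(3) lead_point_def using wpoint_eq_if_mem mem_iff by blast
  qed
  ultimately show ?thesis
    using inj unfolding bij_betw_def by blast
qed


subsection \<open>Solutions over the covering\<close>

lemma open_regular_params: "open (regular_params p)"
proof -
  have "continuous_on UNIV (discr p)"
    unfolding discr_def case_prod_unfold
    by (cases "p = 3"; cases "p = 4") (auto intro!: continuous_intros)
  then show ?thesis
    unfolding regular_params_def by (intro open_Collect_neq) auto
qed

text \<open>In the chart of a local section q, the function h is just f. Agreement of h with
  \<open>f \<circ> \<pi>\<close> is asked on C alone because families are extensional, and q takes
  its values in C.\<close>

lemma cover_partials_comp:
  assumes cover: "covering_space C \<pi> (regular_params p)" and "t \<in> C"
    and f: "(f has_derivative (\<lambda>(x, y). a * x + b * y)) (at (\<pi> t))"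
    and h: "\<And>x. x \<in> C \<Longrightarrow> h x = f (\<pi> x)"
  shows "cover_partials C \<pi> h t a b"
proof -
  obtain U V q where U: "t \<in> U" "openin (top_of_set C) U" and V: "\<pi> t \<in> V"
    "openin (top_of_set (regular_params p)) V" and q: "homeomorphism U V \<pi> q"
    by (rule covering_space_local_homeomorphism[OF cover \<open>t \<in> C\<close>])
  have "open V"
    using V(2) open_regular_params openin_open_eq by blast
  have eq: "f g = h (q g)" if "g \<in> V" for g
  proof -
    have "q g \<in> C"
      using homeomorphism_image2[OF q] that openin_imp_subset[OF U(2)] by blast
    then show ?thesis
      using h homeomorphism_apply2[OF q that] by simp
  qed
  have "((\<lambda>g. h (q g)) has_derivative (\<lambda>(x, y). a * x + b * y)) (at (\<pi> t))"
    by (rule has_derivative_transform_within_open[OF f \<open>open V\<close> V(1)]) (rule eq)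
  then show ?thesis
    unfolding cover_partials_def using U \<open>open V\<close> q by blast
qed

lemma cover_holomorphic_imp_continuous_on:
  assumes "cover_holomorphic C \<pi> f"
  shows "continuous_on C f"
  unfolding continuous_on_def
proof
  fix t assume "t \<in> C"
  then obtain a b where "cover_partials C \<pi> f t a b"
    using assms unfolding cover_holomorphic_def by blast
  then obtain U V q where U: "openin (top_of_set C) U" "t \<in> U" and q: "homeomorphism U V \<pi> q"
    and D: "((\<lambda>g. f (q g)) has_derivative (\<lambda>(h, k). a * h + b * k)) (at (\<pi> t))"
    unfolding cover_partials_def by (elim exE conjE)
  obtain T where T: "open T" "U = C \<inter> T"
    using U(1) by (auto simp: openin_open)
  have "(\<pi> \<longlongrightarrow> \<pi> t) (at t within U)"
    using homeomorphism_cont1[OF q] U(2) by (auto simp: continuous_on_def)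
  \<comment> \<open>Differentiability is known for f after q, so f is written on U as this function
    composed with \<pi>.\<close>
  then have "((\<lambda>x. f (q (\<pi> x))) \<longlongrightarrow> f (q (\<pi> t))) (at t within U)"
    by (rule isCont_tendsto_compose[OF has_derivative_continuous[OF D]])
  moreover have "eventually (\<lambda>x. f (q (\<pi> x)) = f x) (at t within U)"
    unfolding eventually_at_filter by (simp add: homeomorphism_apply1[OF q])
  ultimately have "(f \<longlongrightarrow> f t) (at t within U)"
    using tendsto_cong[of "\<lambda>x. f (q (\<pi> x))" f] homeomorphism_apply1[OF q U(2)] by auto
  \<comment> \<open>U is a neighbourhood of t in C, so it has the same limits at t.\<close>
  moreover have "at t within U = at t within C"
    using U(2) T by (intro at_within_nhd[of t T]) auto
  ultimately show "(f \<longlongrightarrow> f t) (at t within C)"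
    by simp
qed

lemma polar_solutions_pullback:
  assumes p: "p \<in> {3, 4, 6}" and cover: "covering_space C \<pi> (regular_params p)" and "C \<noteq> {}"
    and sol: "\<And>g. polar_solution p g (X g) (Y g)"
    and X: "\<And>n. rational_weighted_poly p (wt_x p - of_int n * wt_z p) (\<lambda>g. X g $$ n)"
    and Y: "\<And>n. rational_weighted_poly p (wt_y p - of_int n * wt_z p) (\<lambda>g. Y g $$ n)"
  shows "(restrict (\<lambda>t. X (\<pi> t)) C, restrict (\<lambda>t. Y (\<pi> t)) C) \<in> polar_solutions p C \<pi>"
proof -
  note lead = polar_solution_leading[OF p sol]
  have family: "laurent_family C \<pi> (restrict (\<lambda>t. Z (\<pi> t)) C) \<and>
      homogeneous_family p C \<pi> w (restrict (\<lambda>t. Z (\<pi> t)) C)"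
    if Z: "\<And>n. rational_weighted_poly p (w - of_int n * wt_z p) (\<lambda>g. Z g $$ n)"
      and low: "\<And>g n. n < m \<Longrightarrow> Z g $$ n = 0" for Z w m
  proof -
    have *: "\<exists>a b. cover_partials C \<pi> (\<lambda>t. restrict (\<lambda>t. Z (\<pi> t)) C t $$ n) t a b \<and>
        of_rat (wt_gs p) * fst (\<pi> t) * a + of_rat (wt_gl p) * snd (\<pi> t) * b =
        of_rat (w - of_int n * wt_z p) * restrict (\<lambda>t. Z (\<pi> t)) C t $$ n" if "t \<in> C" for t n
    proof -
      obtain a b where ab: "((\<lambda>g. Z g $$ n) has_derivative (\<lambda>(h, k). a * h + b * k)) (at (\<pi> t))"
        "of_rat (wt_gs p) * fst (\<pi> t) * a + of_rat (wt_gl p) * snd (\<pi> t) * b =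
          of_rat (w - of_int n * wt_z p) * Z (\<pi> t) $$ n"
        using rational_weighted_poly_derivatives[OF Z, of n "\<pi> t"] by blast
      have "cover_partials C \<pi> (\<lambda>t. restrict (\<lambda>t. Z (\<pi> t)) C t $$ n) t a b"
        by (rule cover_partials_comp[OF cover that ab(1)]) simp
      then show ?thesis
        using ab(2) that by auto
    qed
    have "laurent_family C \<pi> (restrict (\<lambda>t. Z (\<pi> t)) C)"
      unfolding laurent_family_def cover_holomorphic_def
    proof (intro conjI allI ballI)
      show "\<exists>m. \<forall>n<m. \<forall>t\<in>C. restrict (\<lambda>t. Z (\<pi> t)) C t $$ n = 0"
        by (intro exI[of _ m]) (simp add: low)
      fix n t assume "t \<in> C"
      then show "\<exists>a b. cover_partials C \<pi> (\<lambda>t. restrict (\<lambda>t. Z (\<pi> t)) C t $$ n) t a b"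
        using * by blast
    qed simp
    moreover have "homogeneous_family p C \<pi> w (restrict (\<lambda>t. Z (\<pi> t)) C)"
      unfolding homogeneous_family_def cover_weighted_homogeneous_def using * by blast
    ultimately show ?thesis
      by blast
  qed
  have "formal_solution p C \<pi> (restrict (\<lambda>t. X (\<pi> t)) C, restrict (\<lambda>t. Y (\<pi> t)) C)"
    using family[OF X lead(2)] family[OF Y lead(3)] sol
    unfolding formal_solution_def polar_solution_def by simp
  moreover have "has_pole C (restrict (\<lambda>t. X (\<pi> t)) C) \<or> has_pole C (restrict (\<lambda>t. Y (\<pi> t)) C)"
  proof -
    obtain t where "t \<in> C"
      using \<open>C \<noteq> {}\<close> by blast
    moreover obtain n where "n < 0" "X (\<pi> t) $$ n \<noteq> 0 \<or> Y (\<pi> t) $$ n \<noteq> 0"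
      using sol[of "\<pi> t"] by (auto simp: polar_solution_def)
    ultimately show ?thesis
      unfolding has_pole_def by (metis restrict_apply')
  qed
  ultimately show ?thesis
    by (simp add: polar_solutions_def)
qed

text \<open>
  The leading coefficients depend continuously on the point of the covering and take finitely many
  values, zero being the value at the points without pole. Hence the pole and its type persist
  over the whole connected covering.
\<close>

lemma polar_solutions_pointwise:
  assumes p: "p \<in> {3, 4, 6}" and "connected C" and s: "(X, Y) \<in> polar_solutions p C \<pi>"
  shows "\<exists>a\<in>leads p. \<forall>t\<in>C. polar_solution p (\<pi> t) (X t) (Y t) \<and> laurent_lead p (X t) (Y t) = a"
proof -
  have sol: "polar_solution p (\<pi> t) (X t) (Y t)"
    if "t \<in> C" "\<exists>n<0. X t $$ n \<noteq> 0 \<or> Y t $$ n \<noteq> 0" for t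
    using s that unfolding polar_solutions_def formal_solution_def polar_solution_def by auto
  have neg: "- int (pw_x p) < 0" "- int (pw_y p) < 0"
    by (simp_all add: pw_x_def pw_y_def)
  have range: "laurent_lead p (X t) (Y t) \<in> insert (0, 0) (leads p)" if "t \<in> C" for t
  proof (cases "\<exists>n<0. X t $$ n \<noteq> 0 \<or> Y t $$ n \<noteq> 0")
    case True
    then show ?thesis
      using polar_solution_leading(1)[OF p sol[OF that]] by blast
  next
    case False
    then have "laurent_lead p (X t) (Y t) = (0, 0)"
      using neg unfolding laurent_lead_def by blast
    then show ?thesis
      by simp
  qed
  have "finite (leads p)"
    by (simp add: leads_def)
  have "continuous_on C (\<lambda>t. X t $$ n)" "continuous_on C (\<lambda>t. Y t $$ n)" for n
  proof -
    have "laurent_family C \<pi> X" "laurent_family C \<pi> Y"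
      using s by (simp_all add: polar_solutions_def formal_solution_def)
    then show "continuous_on C (\<lambda>t. X t $$ n)" "continuous_on C (\<lambda>t. Y t $$ n)"
      unfolding laurent_family_def using cover_holomorphic_imp_continuous_on by blast+
  qed
  moreover have "finite ((\<lambda>t. X t $$ (- int (pw_x p))) ` C)"
    by (rule finite_subset[of _ "fst ` insert (0, 0) (leads p)"])
      (use range \<open>finite (leads p)\<close> in \<open>force simp: laurent_lead_def\<close>)+
  moreover have "finite ((\<lambda>t. Y t $$ (- int (pw_y p))) ` C)"
    by (rule finite_subset[of _ "snd ` insert (0, 0) (leads p)"])
      (use range \<open>finite (leads p)\<close> in \<open>force simp: laurent_lead_def\<close>)+
  ultimately have "(\<lambda>t. X t $$ (- int (pw_x p))) constant_on C" "(\<lambda>t. Y t $$ (- int (pw_y p))) constant_on C"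
    using continuous_finite_range_constant[OF \<open>connected C\<close>] by blast+
  then obtain a where a: "\<And>t. t \<in> C \<Longrightarrow> laurent_lead p (X t) (Y t) = a"
    unfolding constant_on_def laurent_lead_def by metis
  obtain t where t: "t \<in> C" "\<exists>n<0. X t $$ n \<noteq> 0 \<or> Y t $$ n \<noteq> 0"
    using s unfolding polar_solutions_def has_pole_def by auto
  then have "a \<in> leads p"
    using polar_solution_leading(1)[OF p sol] a by metis
  moreover have "polar_solution p (\<pi> t) (X t) (Y t)" if "t \<in> C" for t
  proof (rule sol[OF that])
    have "laurent_lead p (X t) (Y t) \<noteq> (0, 0)"
      using a[OF that] \<open>a \<in> leads p\<close> zero_notin_leads by metis
    then show "\<exists>n<0. X t $$ n \<noteq> 0 \<or> Y t $$ n \<noteq> 0"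
      using neg unfolding laurent_lead_def by (metis prod.inject)
  qed
  ultimately show ?thesis
    using a by blast
qed

theorem lemma7p1:
  fixes p :: nat
    and C :: "'a::topological_space set"
    and \<pi> :: "'a \<Rightarrow> complex \<times> complex"
  assumes "p \<in> {3, 4, 6}"
    and "monodromy_covering p C \<pi>"
  shows "card (polar_solutions p C \<pi>) = p div 2 \<and>
    (\<exists>\<Lambda>. (\<forall>s \<in> polar_solutions p C \<pi>. \<forall>t \<in> C. laurent_limit p (fst s t) (snd s t) (\<Lambda> s)) \<and>
      (\<forall>t \<in> C. bij_betw \<Lambda> (polar_solutions p C \<pi>) (points_at_infinity p (\<pi> t))) \<and>
      (\<forall>s \<in> polar_solutions p C \<pi>.
        polar_solutions p C \<pi> = {(sigma_family p C ^^ k) s | k. k < p div 2} \<and>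
        sigma_family p C s \<in> polar_solutions p C \<pi> \<and>
        \<Lambda> (sigma_family p C s) = sigma_wpoint p (\<Lambda> s))) \<and>
    (\<forall>(X, Y) \<in> polar_solutions p C \<pi>. \<forall>n.
      (\<exists>f. rational_weighted_poly p (wt_x p - of_int n * wt_z p) f \<and>
           (\<forall>t \<in> C. fls_nth (X t) n = f (\<pi> t))) \<and>
      (\<exists>f. rational_weighted_poly p (wt_y p - of_int n * wt_z p) f \<and>
           (\<forall>t \<in> C. fls_nth (Y t) n = f (\<pi> t))))"
proof -
  note p = assms(1)
  have cover: "covering_space C \<pi> (regular_params p)" and "connected C"
    using assms(2) by (auto simp: monodromy_covering_def)
  \<comment> \<open>The discriminant at (1, 0) is 1, 1, 16 for p = 3, 4, 6. As the covering map is
    surjective, C contains a point, at which solutions can be told apart.\<close>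
  have "(1, 0) \<in> regular_params p"
    by (simp add: regular_params_def discr_def)
  then obtain t0 where t0: "t0 \<in> C"
    using covering_space_imp_surjective[OF cover] by blast
  have "\<forall>a. \<exists>X Y. a \<in> leads p \<longrightarrow> (\<forall>g. polar_solution p g (X g) (Y g) \<and> laurent_lead p (X g) (Y g) = a \<and>
    (\<forall>n. rational_weighted_poly p (wt_x p - of_int n * wt_z p) (\<lambda>g. X g $$ n) \<and>
         rational_weighted_poly p (wt_y p - of_int n * wt_z p) (\<lambda>g. Y g $$ n)))"
    using polar_solution_exists[OF p] by blast
  then obtain X Y where "\<forall>a. a \<in> leads p \<longrightarrow> (\<forall>g. polar_solution p g (X a g) (Y a g) \<and>
    laurent_lead p (X a g) (Y a g) = a \<and>
    (\<forall>n. rational_weighted_poly p (wt_x p - of_int n * wt_z p) (\<lambda>g. X a g $$ n) \<and>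
         rational_weighted_poly p (wt_y p - of_int n * wt_z p) (\<lambda>g. Y a g $$ n)))"
    unfolding choice_iff by blast
  then have XY: "polar_solution p g (X a g) (Y a g)" "laurent_lead p (X a g) (Y a g) = a"
    "rational_weighted_poly p (wt_x p - of_int n * wt_z p) (\<lambda>g. X a g $$ n)"
    "rational_weighted_poly p (wt_y p - of_int n * wt_z p) (\<lambda>g. Y a g $$ n)"
    if "a \<in> leads p" for a g n
    using that by blast+
  define S where "S a = (restrict (\<lambda>t. X a (\<pi> t)) C, restrict (\<lambda>t. Y a (\<pi> t)) C)" for a
  have S: "S a \<in> polar_solutions p C \<pi>" if "a \<in> leads p" for a
    unfolding S_def using that t0 by (intro polar_solutions_pullback[OF p cover] XY) auto
  \<comment> \<open>Uniqueness at each parameter gives agreement on C, and extensionality turns it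
    into equality of families. Applied both to an arbitrary solution and to the image of a known one
    under sigma.\<close>
  have eq_S: "s = S a" if "fst s \<in> extensional C" "snd s \<in> extensional C" "a \<in> leads p"
    "\<And>t. t \<in> C \<Longrightarrow> polar_solution p (\<pi> t) (fst s t) (snd s t) \<and> laurent_lead p (fst s t) (snd s t) = a"
    for s a
  proof -
    have "fst s t = X a (\<pi> t) \<and> snd s t = Y a (\<pi> t)" if "t \<in> C" for t
      using polar_solution_unique[OF p] XY(1,2)[OF \<open>a \<in> leads p\<close>]
        \<open>\<And>t. t \<in> C \<Longrightarrow> polar_solution p (\<pi> t) (fst s t) (snd s t) \<and> laurent_lead p (fst s t) (snd s t) = a\<close>[OF that]
      by metis
    then show ?thesis
      unfolding S_def using that(1,2) by (intro prod_eqI extensionalityI[of _ C]) auto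
  qed
  have sols: "polar_solutions p C \<pi> = S ` leads p"
  proof (intro equalityI subsetI)
    fix s assume s: "s \<in> polar_solutions p C \<pi>"
    then have "(fst s, snd s) \<in> polar_solutions p C \<pi>"
      by simp
    from polar_solutions_pointwise[OF p \<open>connected C\<close> this]
    obtain a where "a \<in> leads p"
      "\<And>t. t \<in> C \<Longrightarrow> polar_solution p (\<pi> t) (fst s t) (snd s t) \<and> laurent_lead p (fst s t) (snd s t) = a"
      by blast
    moreover have "fst s \<in> extensional C" "snd s \<in> extensional C"
      using s by (auto simp: polar_solutions_def formal_solution_def laurent_family_def split: prod.splits)
    ultimately show "s \<in> S ` leads p"
      using eq_S by blast
  qed (use S in auto)
  \<comment> \<open>The leading coefficients are constant along C, so the single point
    \<open>t0\<close> suffices to read them.\<close>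
  define lead where "lead s = laurent_lead p (fst s t0) (snd s t0)"
    for s :: "('a \<Rightarrow> complex fls) \<times> ('a \<Rightarrow> complex fls)"
  have lead_S: "lead (S a) = a" if "a \<in> leads p" for a
    using XY(2)[OF that] t0 by (simp add: lead_def S_def)
  have bij: "bij_betw lead (polar_solutions p C \<pi>) (leads p)"
    unfolding sols by (rule bij_betw_byWitness[where f' = S]) (auto simp: lead_S)
  have sigma_S: "sigma_family p C (S a) = S (sigma p a)" if a: "a \<in> leads p" for a
  proof (rule eq_S)
    fix t assume "t \<in> C"
    then show "polar_solution p (\<pi> t) (fst (sigma_family p C (S a)) t) (snd (sigma_family p C (S a)) t) \<and>
        laurent_lead p (fst (sigma_family p C (S a)) t) (snd (sigma_family p C (S a)) t) = sigma p a"
      using polar_solution_sigma[OF p XY(1)[OF a]] laurent_lead_sigma[OF p] XY(2)[OF a]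
      by (simp add: sigma_family_def S_def)
  qed (simp_all add: sigma_family_def sigma_leads(1)[OF p a])
  have sigma_iterate: "(sigma_family p C ^^ k) (S a) = S ((sigma p ^^ k) a) \<and> (sigma p ^^ k) a \<in> leads p"
    if a: "a \<in> leads p" for a k
    by (induction k) (auto simp: a sigma_S sigma_leads(1)[OF p])
  have "card (leads p) = p div 2"
    using p by (auto simp: leads_def)
  then have "card (polar_solutions p C \<pi>) = p div 2"
    using bij_betw_same_card[OF bij] by simp
  moreover have "\<exists>\<Lambda>. (\<forall>s \<in> polar_solutions p C \<pi>. \<forall>t \<in> C. laurent_limit p (fst s t) (snd s t) (\<Lambda> s)) \<and>
      (\<forall>t \<in> C. bij_betw \<Lambda> (polar_solutions p C \<pi>) (points_at_infinity p (\<pi> t))) \<and>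
      (\<forall>s \<in> polar_solutions p C \<pi>.
        polar_solutions p C \<pi> = {(sigma_family p C ^^ k) s | k. k < p div 2} \<and>
        sigma_family p C s \<in> polar_solutions p C \<pi> \<and>
        \<Lambda> (sigma_family p C s) = sigma_wpoint p (\<Lambda> s))"
  \<comment> \<open>The homogenized equation at w = 0 does not involve g, so the points at infinity
    are the same for all parameters and one map serves all t.\<close>
  proof (intro exI[of _ "\<lambda>s. lead_point p (lead s)"] conjI ballI)
    fix s t assume s: "s \<in> polar_solutions p C \<pi>" and t: "t \<in> C"
    obtain a where a: "a \<in> leads p" "s = S a"
      using s sols by blast
    then show "laurent_limit p (fst s t) (snd s t) (lead_point p (lead s))"
      using laurent_limit_lead_point[OF p XY(1)[OF a(1)]] XY(2)[OF a(1)] t lead_S by (simp add: S_def)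
  next
    fix t
    show "bij_betw (\<lambda>s. lead_point p (lead s)) (polar_solutions p C \<pi>) (points_at_infinity p (\<pi> t))"
      using bij_betw_trans[OF bij lead_point_bij[OF p]] by (simp add: comp_def)
  next
    fix s assume "s \<in> polar_solutions p C \<pi>"
    then obtain a where a: "a \<in> leads p" "s = S a"
      using sols by blast
    have "S ` leads p = {S ((sigma p ^^ k) a) | k. k < p div 2}"
      using sigma_leads(2)[OF p a(1)] by auto
    then show "polar_solutions p C \<pi> = {(sigma_family p C ^^ k) s | k. k < p div 2}"
      using sigma_iterate[OF a(1)] by (simp add: sols a(2))
    show "sigma_family p C s \<in> polar_solutions p C \<pi>"
      using sigma_S[OF a(1)] S sigma_leads(1)[OF p a(1)] by (simp add: a(2))
    show "lead_point p (lead (sigma_family p C s)) = sigma_wpoint p (lead_point p (lead s))"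
      using sigma_S lead_S sigma_leads(1)[OF p] a by (simp add: sigma_lead_point)
  qed
  moreover have "\<forall>(X, Y) \<in> polar_solutions p C \<pi>. \<forall>n.
      (\<exists>f. rational_weighted_poly p (wt_x p - of_int n * wt_z p) f \<and>
           (\<forall>t \<in> C. fls_nth (X t) n = f (\<pi> t))) \<and>
      (\<exists>f. rational_weighted_poly p (wt_y p - of_int n * wt_z p) f \<and>
           (\<forall>t \<in> C. fls_nth (Y t) n = f (\<pi> t)))"
    unfolding sols
  proof (clarify, intro conjI)
    fix X' Y' a n assume a: "a \<in> leads p" and S_a: "(X', Y') = S a"
    have "\<forall>t \<in> C. fls_nth (X' t) n = X a (\<pi> t) $$ n" "\<forall>t \<in> C. fls_nth (Y' t) n = Y a (\<pi> t) $$ n"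
      using S_a by (simp_all add: S_def)
    then show "\<exists>f. rational_weighted_poly p (wt_x p - of_int n * wt_z p) f \<and>
           (\<forall>t \<in> C. fls_nth (X' t) n = f (\<pi> t))"
       "\<exists>f. rational_weighted_poly p (wt_y p - of_int n * wt_z p) f \<and>
           (\<forall>t \<in> C. fls_nth (Y' t) n = f (\<pi> t))"
      using XY(3,4)[OF a] by blast+
  qed
  ultimately show ?thesis
    by blast
qed

end
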